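(* Let $\lambda>0$ and the positive integer $d$ be fixed. For each $n$, let $\tau(\tfrac12,\mathbf{0})$ be the mixing time, with $\varepsilon=\tfrac12$, of the load vector process of the $n$-bin system with $d$ choices started from the state $\mathbf{0}$ with no balls. Then $\tau(\tfrac12,\mathbf{0})=\Theta(\ln n)$ as $n\to\infty$.
   Context: The model ($n$-bin system): let $\lambda>0$ and let $d,n$ be positive integers. There are $n$ bins. Balls arrive in a Poisson process at rate $\lambda n$. Upon arrival each ball chooses $d$ bins independently and uniformly at random (with replacement), and is placed into a least loaded bin among those chosen (load = number of balls in the bin); if there is more than one chosen bin with least load, the ball is placed in the first such bin chosen. Balls have independent exponential lifetimes with mean $1$, after which they disappear. $X_t(j)$ is the number of balls in bin $j$ at time $t$, and $X_t=(X_t(1),\dots,X_t(n))$ is the load vector. $(X_t)$ is a continuous-time Markov chain on $(\mathbb{Z}^+)^n$ with a unique stationary distribution $\mathbf{\Pi}$. For $\varepsilon>0$ and an initial state $x$, the mixing time is $\tau(\varepsilon,x)=\inf\{t\ge 0: d_{\mathrm{TV}}(\mathcal{L}(X_t),\mathbf{\Pi})\le\varepsilon\}$, where $X_0=x$ almost surely, $\mathcal{L}$ denotes law and $d_{\mathrm{TV}}(\mu_1,\mu_2)=\max_A|\mu_1(A)-\mu_2(A)|$. *)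

theory Defs
  imports "HOL-Probability.Probability" "HOL-Library.Landau_Symbols"
begin

text \<open>
  The state space is the set of lists of length \<open>n\<close> over the naturals: \<open>x ! j\<close> is the load of
  bin \<open>j < n\<close>.  (Lists rather than functions, so that the state type is countable.)

  An outcome \<open>(r, a)\<close> consists of the residual lifetimes \<open>r (j, k)\<close> of the \<open>k\<close>-th ball
  initially in bin \<open>j\<close>, and of the triples \<open>a m = (gap, cs, s)\<close> for the \<open>m\<close>-th arriving ball:
  the time since the previous arrival, the list of the bins it chooses (in the order of choosing)
  and its lifetime.
\<close>

type_synonym outcome = "(nat \<times> nat \<Rightarrow> real) \<times> (nat \<Rightarrow> real \<times> nat list \<times> real)"

definition exponential :: "real \<Rightarrow> real measure" where
  "exponential l = density lborel (\<lambda>s. ennreal (exponential_density l s))"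

definition choices_pmf :: "nat \<Rightarrow> nat \<Rightarrow> nat list pmf" where
  "choices_pmf d n = replicate_pmf d (pmf_of_set {..<n})"

text \<open>
  Everything is independent.  The Poisson process of rate \<open>lam * n\<close> is the one whose
  inter-arrival times are independent exponential variables of that rate.  The residual
  lifetimes of balls present at time \<open>0\<close> are exponential of mean \<open>1\<close>, by lack of memory.
\<close>

definition outcomes :: "real \<Rightarrow> nat \<Rightarrow> nat \<Rightarrow> outcome measure" where
  "outcomes lam d n =
     (\<Pi>\<^sub>M i\<in>UNIV. exponential 1) \<Otimes>\<^sub>M
     (\<Pi>\<^sub>M m\<in>UNIV. exponential (lam * real n) \<Otimes>\<^sub>M (measure_pmf (choices_pmf d n) \<Otimes>\<^sub>M exponential 1))"

definition arrival :: "outcome \<Rightarrow> nat \<Rightarrow> real" where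
  "arrival w m = (\<Sum>k\<le>m. fst (snd w k))"

definition choices :: "outcome \<Rightarrow> nat \<Rightarrow> nat list" where
  "choices w m = fst (snd (snd w m))"

definition lifetime :: "outcome \<Rightarrow> nat \<Rightarrow> real" where
  "lifetime w m = snd (snd (snd w m))"

definition initial_load :: "nat list \<Rightarrow> outcome \<Rightarrow> real \<Rightarrow> nat \<Rightarrow> nat" where
  "initial_load x w t j = card {k. k < x ! j \<and> t < fst w (j, k)}"

text \<open>
  The bin into which the \<open>m\<close>-th arriving ball is placed, when the initial state is \<open>x\<close>.  The
  function minimised is the load at the arrival time; \<^const>\<open>arg_min_list\<close> returns the first
  minimiser in the list.
\<close>

fun ball_bin :: "nat list \<Rightarrow> outcome \<Rightarrow> nat \<Rightarrow> nat" where
  "ball_bin x w m =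
     arg_min_list
       (\<lambda>j. initial_load x w (arrival w m) j +
            (\<Sum>k<m. of_bool (ball_bin x w k = j \<and> arrival w m < arrival w k + lifetime w k)))
       (choices w m)"

declare ball_bin.simps [simp del]

definition load :: "nat list \<Rightarrow> outcome \<Rightarrow> real \<Rightarrow> nat \<Rightarrow> nat" where
  "load x w t j = initial_load x w t j +
     card {m. ball_bin x w m = j \<and> arrival w m \<le> t \<and> t < arrival w m + lifetime w m}"

definition load_vector :: "nat \<Rightarrow> nat list \<Rightarrow> real \<Rightarrow> outcome \<Rightarrow> nat list" where
  "load_vector n x t w = map (load x w t) [0..<n]"

text \<open>The law of \<open>X\<^sub>t\<close> when \<open>X\<^sub>0 = x\<close>, that is, the transition kernel.\<close>

definition load_law :: "real \<Rightarrow> nat \<Rightarrow> nat \<Rightarrow> nat list \<Rightarrow> real \<Rightarrow> nat list measure" where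
  "load_law lam d n x t = distr (outcomes lam d n) (count_space UNIV) (load_vector n x t)"

definition stationary :: "real \<Rightarrow> nat \<Rightarrow> nat \<Rightarrow> nat list pmf \<Rightarrow> bool" where
  "stationary lam d n P \<longleftrightarrow>
     set_pmf P \<subseteq> {x. length x = n} \<and>
     (\<forall>t\<ge>0. \<forall>A. measure_pmf.expectation P (\<lambda>x. measure (load_law lam d n x t) A) = measure_pmf.prob P A)"

definition tv_dist :: "'a measure \<Rightarrow> 'a measure \<Rightarrow> real" where
  "tv_dist M N = (SUP A\<in>sets M. \<bar>measure M A - measure N A\<bar>)"

text \<open>The mixing time is extended-real valued, so that the infimum of the empty set is \<open>\<infinity>\<close>.\<close>

definition mixing_time ::
  "real \<Rightarrow> nat \<Rightarrow> nat \<Rightarrow> nat list pmf \<Rightarrow> real \<Rightarrow> nat list \<Rightarrow> ereal" where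
  "mixing_time lam d n P \<epsilon> x =
     Inf (ereal ` {t. t \<ge> 0 \<and> tv_dist (load_law lam d n x t) (measure_pmf P) \<le> \<epsilon>})"

end

theory Submission
  imports Defs
begin

text \<open>
  Upper bound: a system started from \<open>x\<close> with one extra ball is compared with the system started
  from \<open>x\<close> by treating the extra ball as second class, invisible to the others.  When an arriving
  ball would join the bin of the live extra ball \<open>e\<close> in the smaller system, the larger system may
  place it in another bin; there the newcomer takes over the role of the extra ball, and \<open>e\<close> that
  of the newcomer.  By lack of memory, exchanging the residual lifetimes of these two balls
  preserves the law, so the role of the extra ball ends at an exponential time of mean 1.
  Hence the two laws at time \<open>t\<close> differ by at most \<open>exp (- t)\<close>, and the law started from \<open>x\<close>
  differs from that started from no balls by at most \<open>exp (- t)\<close> times the number of balls of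
  \<open>x\<close>, which in equilibrium is of order \<open>n\<close>.

  Lower bound: started from no balls, the number of balls at time \<open>t\<close> has mean
  \<open>lam * n * (1 - exp (- t))\<close> and at most that variance.  For \<open>t \<le> ln n / 4\<close> the mean is at least
  \<open>lam * n powr (3/4)\<close> below the equilibrium value \<open>lam * n\<close>, which exceeds the standard deviation,
  of order \<open>sqrt n\<close>.
\<close>

section \<open>A second-class ball\<close>

lemma arg_min_list_le: "xs \<noteq> [] \<Longrightarrow> y \<in> set xs \<Longrightarrow> f (arg_min_list f xs) \<le> f y"
  by (simp add: f_arg_min_list_f)

text \<open>Raising a value that did not win cannot create a new winner, and ties keep their order.
  This is why the extra ball influences an arriving ball only if that ball would join the extra
  ball's own bin.\<close>

lemma arg_min_list_bump:
  fixes f :: "'a \<Rightarrow> nat"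
  assumes "c \<noteq> []" and "arg_min_list f c \<noteq> J"
  shows "arg_min_list (\<lambda>j. f j + of_bool (j = J)) c = arg_min_list f c"
  using assms
proof (induction c rule: induct_list012)
  case (3 x y zs)
  let ?g = "\<lambda>j. f j + of_bool (j = J)"
  define m m' where "m = arg_min_list f (y # zs)" and "m' = arg_min_list ?g (y # zs)"
  have "m' \<in> set (y # zs)"
    unfolding m'_def by (rule arg_min_list_in) simp
  \<comment> \<open>Used when \<open>m = J\<close>: then \<open>x\<close> wins against
    \<open>J\<close>, and so against every entry of the tail, whichever of them is chosen under
    \<open>?g\<close>.\<close>
  then have "f m \<le> f m'"
    unfolding m_def by (intro arg_min_list_le) auto
  moreover have "m \<noteq> J \<Longrightarrow> m' = m"
    using 3 by (simp add: m_def m'_def)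
  ultimately show ?case
    using 3(4) by (auto simp: Let_def simp flip: m_def m'_def split: if_splits)
qed auto

definition load_before :: "nat list \<Rightarrow> outcome \<Rightarrow> nat \<Rightarrow> nat \<Rightarrow> nat" where
  "load_before x w m j = initial_load x w (arrival w m) j +
     (\<Sum>k<m. of_bool (ball_bin x w k = j \<and> arrival w m < arrival w k + lifetime w k))"

lemma ball_bin_eq: "ball_bin x w m = arg_min_list (load_before x w m) (choices w m)"
  by (subst ball_bin.simps) (simp add: load_before_def[abs_def])

text \<open>
  The position of the second-class ball, initially in bin \<open>i\<close>, after \<open>m\<close> arrivals; it is frozen at
  time \<open>t\<close>, and ignores that the ball may have died, which makes it independent of the ball's
  lifetime.
\<close>

fun extra_bin :: "nat list \<Rightarrow> real \<Rightarrow> nat \<Rightarrow> outcome \<Rightarrow> nat \<Rightarrow> nat" where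
  "extra_bin x t i w 0 = i"
| "extra_bin x t i w (Suc m) =
     (if arrival w m \<le> t \<and> ball_bin x w m = extra_bin x t i w m
      then arg_min_list (\<lambda>j. load_before x w m j + of_bool (j = extra_bin x t i w m)) (choices w m)
      else extra_bin x t i w m)"

text \<open>The extra ball of \<open>x[i := Suc (x ! i)]\<close> is the one with index \<open>x ! i\<close> in bin \<open>i\<close>.\<close>

definition extra_lifetime :: "nat list \<Rightarrow> nat \<Rightarrow> outcome \<Rightarrow> real" where
  "extra_lifetime x i w = fst w (i, x ! i)"

text \<open>
  The extra ball is second class up to the \<open>M\<close>-th arrival, and an ordinary ball from then on.
  For \<open>M = 0\<close> this is the system started from \<open>x[i := Suc (x ! i)]\<close>.
\<close>

fun hybrid_bin :: "nat list \<Rightarrow> real \<Rightarrow> nat \<Rightarrow> nat \<Rightarrow> outcome \<Rightarrow> nat \<Rightarrow> nat" where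
  "hybrid_bin x t i M w m =
     (if m < M then ball_bin x w m
      else arg_min_list
       (\<lambda>j. initial_load x w (arrival w m) j +
            of_bool (j = extra_bin x t i w M \<and> arrival w m < extra_lifetime x i w) +
            (\<Sum>k<m. of_bool (hybrid_bin x t i M w k = j \<and> arrival w m < arrival w k + lifetime w k)))
       (choices w m))"

declare hybrid_bin.simps [simp del]

definition hybrid_load :: "nat list \<Rightarrow> real \<Rightarrow> nat \<Rightarrow> nat \<Rightarrow> outcome \<Rightarrow> nat \<Rightarrow> nat" where
  "hybrid_load x t i M w j = initial_load x w t j +
     of_bool (j = extra_bin x t i w M \<and> t < extra_lifetime x i w) +
     card {m. hybrid_bin x t i M w m = j \<and> arrival w m \<le> t \<and> t < arrival w m + lifetime w m}"

text \<open>The two lifetimes are free arguments so that the swap can be studied, with the rest of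
  the outcome fixed, as a map of two independent exponential variables. \<open>y\<close> is counted
  from time 0 and \<open>z\<close> from the \<open>M\<close>-th arrival, whence the shifts by
  \<open>arrival w M\<close> in \<open>swap\<close>.\<close>

definition resample :: "nat list \<Rightarrow> nat \<Rightarrow> nat \<Rightarrow> outcome \<Rightarrow> real \<Rightarrow> real \<Rightarrow> outcome" where
  "resample x i M w y z =
     ((fst w)((i, x ! i) := y), (snd w)(M := (fst (snd w M), fst (snd (snd w M)), z)))"

text \<open>Whether the extra ball is alive is left to \<open>swap\<close>, so that this condition
  depends on neither of the two lifetimes. The conjunct \<open>0 \<le> arrival w M\<close>, true
  almost surely, lets lack of memory be applied at every outcome.\<close>

definition swappable :: "nat list \<Rightarrow> real \<Rightarrow> nat \<Rightarrow> nat \<Rightarrow> outcome \<Rightarrow> bool" where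
  "swappable x t i M w \<longleftrightarrow> 0 \<le> arrival w M \<and> arrival w M \<le> t \<and> ball_bin x w M = extra_bin x t i w M"

text \<open>Exchanges the residual lifetimes, at the \<open>M\<close>-th arrival, of the extra and the arriving ball.\<close>

definition swap :: "nat list \<Rightarrow> real \<Rightarrow> nat \<Rightarrow> nat \<Rightarrow> outcome \<Rightarrow> outcome" where
  "swap x t i M w =
     (if swappable x t i M w \<and> arrival w M < extra_lifetime x i w
      then resample x i M w (arrival w M + lifetime w M) (extra_lifetime x i w - arrival w M)
      else w)"

section \<open>Invariance under resampling the two lifetimes\<close>

lemma arrival_resample [simp]: "arrival (resample x i M w y z) = arrival w"
  by (auto simp: fun_eq_iff arrival_def resample_def intro!: sum.cong)

lemma choices_resample [simp]: "choices (resample x i M w y z) = choices w"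
  by (auto simp: fun_eq_iff choices_def resample_def)

lemma lifetime_resample [simp]:
  "lifetime (resample x i M w y z) m = (if m = M then z else lifetime w m)"
  by (auto simp: lifetime_def resample_def)

lemma initial_load_resample [simp]: "initial_load x (resample x i M w y z) = initial_load x w"
  by (auto simp: fun_eq_iff initial_load_def resample_def intro!: arg_cong[where f = card])

lemma extra_lifetime_resample [simp]: "extra_lifetime x i (resample x i M w y z) = y"
  by (auto simp: extra_lifetime_def resample_def)

text \<open>Up to and including the \<open>M\<close>-th placement only the lifetimes of earlier
  arrivals and of the initial balls of \<open>x\<close> are consulted. Ball \<open>M\<close> is not
  yet among the former, and the extra ball has the index \<open>x ! i\<close>, just beyond those of
  the latter.\<close>

lemma ball_bin_resample: "m \<le> M \<Longrightarrow> ball_bin x (resample x i M w y z) m = ball_bin x w m"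
proof (induction m rule: less_induct)
  case (less m)
  then show ?case
    by (subst (1 2) ball_bin.simps) (auto intro!: arg_cong2[where f = arg_min_list] sum.cong ext)
qed

lemma load_before_resample:
  "m \<le> M \<Longrightarrow> load_before x (resample x i M w y z) m = load_before x w m"
  by (auto simp: load_before_def ball_bin_resample intro!: sum.cong ext)

lemma extra_bin_resample:
  "m \<le> M \<Longrightarrow> extra_bin x t i (resample x i M w y z) m = extra_bin x t i w m"
  by (induction m) (auto simp: ball_bin_resample load_before_resample)

lemma swappable_resample [simp]:
  "swappable x t i M (resample x i M w y z) = swappable x t i M w"
  by (simp add: swappable_def ball_bin_resample extra_bin_resample)

text \<open>The almost sure properties that the pathwise arguments use. Local finiteness of the
  arrivals matters for counting, since \<open>card\<close> of an infinite set is 0.\<close>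

definition regular :: "outcome \<Rightarrow> bool" where
  "regular w \<longleftrightarrow> (\<forall>m. 0 \<le> fst (snd w m) \<and> 0 < lifetime w m \<and> choices w m \<noteq> []) \<and>
     (\<forall>t. finite {m. arrival w m \<le> t})"

lemma regular_arrival_mono: "regular w \<Longrightarrow> m \<le> k \<Longrightarrow> arrival w m \<le> arrival w k"
  unfolding arrival_def by (intro sum_mono2) (auto simp: regular_def)

lemma regular_arrival_nonneg: "regular w \<Longrightarrow> 0 \<le> arrival w m"
  unfolding arrival_def by (intro sum_nonneg) (auto simp: regular_def)

section \<open>Pathwise comparison of consecutive hybrids\<close>

lemma hybrid_bin_less: "m < M \<Longrightarrow> hybrid_bin x t i M w m = ball_bin x w m"
  by (subst hybrid_bin.simps) simp

lemma hybrid_bin_at: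
  "hybrid_bin x t i M w M = arg_min_list
     (\<lambda>j. load_before x w M j +
        of_bool (j = extra_bin x t i w M \<and> arrival w M < extra_lifetime x i w)) (choices w M)"
  by (subst hybrid_bin.simps)
    (auto simp: load_before_def hybrid_bin_less intro!: arg_cong2[where f = arg_min_list] ext)

text \<open>Prolonging the second-class period by one arrival matters only if ball \<open>M\<close>
  arrives by time \<open>t\<close>, finds the extra ball alive and would join its bin
  \<open>?J\<close> in the smaller system. Then hybrid \<open>M\<close> puts the newcomer into
  \<open>?J'\<close> and leaves the extra ball in \<open>?J\<close>, while hybrid
  \<open>Suc M\<close> does the reverse. Exchanging the two residual lifetimes makes the occupied
  bins and the death times coincide.\<close>

lemma hybrid_load_swap:
  assumes "regular w"
  shows "hybrid_load x t i M (swap x t i M w) j = hybrid_load x t i (Suc M) w j"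
proof -
  let ?J = "extra_bin x t i w M" and ?J' = "extra_bin x t i w (Suc M)"
  let ?T = "arrival w" and ?r = "extra_lifetime x i w"
  consider (late) "t < ?T M" | (apart) "?T M \<le> t" "ball_bin x w M \<noteq> ?J"
    | (dead) "?T M \<le> t" "?r \<le> ?T M"
    | (swap) "?T M \<le> t" "ball_bin x w M = ?J" "?T M < ?r"
    by linarith
  then show ?thesis
  proof cases
    case late
    have *: "swap x t i M w = w"
      using late by (auto simp: swap_def swappable_def)
    \<comment> \<open>All arrivals counted at time \<open>t\<close> precede \<open>M\<close>, and
      there both hybrids follow \<open>ball_bin\<close>.\<close>
    have "m < M" if "?T m \<le> t" for m
      using regular_arrival_mono[OF assms, of M m] that late by linarith
    then have "{m. hybrid_bin x t i M w m = j \<and> ?T m \<le> t \<and> t < ?T m + lifetime w m} =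
        {m. hybrid_bin x t i (Suc M) w m = j \<and> ?T m \<le> t \<and> t < ?T m + lifetime w m}"
      by (auto simp: hybrid_bin_less less_SucI)
    with late show ?thesis
      by (simp add: hybrid_load_def *)
  next
    case apart
    have *: "swap x t i M w = w"
      using apart by (auto simp: swap_def swappable_def)
    have "choices w M \<noteq> []" using assms by (auto simp: regular_def)
    \<comment> \<open>The smaller system avoids \<open>?J\<close>, so the newcomer's choice is the
      same whether or not a live extra ball adds to the load of \<open>?J\<close>.\<close>
    then have M: "hybrid_bin x t i M w M = ball_bin x w M"
      using apart arg_min_list_bump[of "choices w M" "load_before x w M" ?J]
      by (cases "?T M < ?r") (auto simp: hybrid_bin_at ball_bin_eq)
    have "hybrid_bin x t i M w m = hybrid_bin x t i (Suc M) w m" for m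
    proof (induction m rule: less_induct)
      case (less m)
      consider "m < M" | "m = M" | "m > M" by linarith
      then show ?case
      proof cases
        case 3
        then show ?thesis
          using less apart(2)
          by (subst (1 2) hybrid_bin.simps) (auto intro!: arg_cong2[where f = arg_min_list] sum.cong ext)
      qed (auto simp: hybrid_bin_less M)
    qed
    then show ?thesis
      using apart by (simp add: hybrid_load_def *)
  next
    case dead
    have *: "swap x t i M w = w"
      using dead by (auto simp: swap_def)
    have d: "\<not> ?T m < ?r" if "M \<le> m" for m
      using regular_arrival_mono[OF assms that] dead by linarith
    have M: "hybrid_bin x t i M w M = ball_bin x w M"
      using d[of M] by (simp add: hybrid_bin_at ball_bin_eq)
    have "hybrid_bin x t i M w m = hybrid_bin x t i (Suc M) w m" for m
    proof (induction m rule: less_induct)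
      case (less m)
      consider "m < M" | "m = M" | "m > M" by linarith
      then show ?case
      proof cases
        case 3
        then show ?thesis
          using less d[of m]
          by (subst (1 2) hybrid_bin.simps) (auto intro!: arg_cong2[where f = arg_min_list] sum.cong ext)
      qed (auto simp: hybrid_bin_less M)
    qed
    then show ?thesis
      using dead by (simp add: hybrid_load_def *)
  next
    case swap
    let ?s = "lifetime w M"
    define w' where "w' = resample x i M w (?T M + ?s) (?r - ?T M)"
    have *: "swap x t i M w = w'"
      using swap regular_arrival_nonneg[OF assms] by (auto simp: swap_def swappable_def w'_def)
    have [simp]: "arrival w' = ?T" "choices w' = choices w" "initial_load x w' = initial_load x w"
        "extra_lifetime x i w' = ?T M + ?s" "extra_bin x t i w' M = ?J"
        "lifetime w' m = (if m = M then ?r - ?T M else lifetime w m)" for m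
      by (simp_all add: w'_def extra_bin_resample)
    have "0 < ?s" using assms by (auto simp: regular_def)
    \<comment> \<open>In \<open>w'\<close> the extra ball dies at \<open>?T M + ?s\<close>; as
      \<open>0 < ?s\<close> it is alive at the \<open>M\<close>-th arrival, and the newcomer sees
      the raised load of \<open>?J\<close>.\<close>
    have q: "hybrid_bin x t i M w' M = ?J'"
      using swap \<open>0 < ?s\<close>
      by (simp add: hybrid_bin_at w'_def extra_bin_resample load_before_resample)
    have b: "hybrid_bin x t i (Suc M) w M = ?J"
      using swap by (simp add: hybrid_bin_less)
    have lt: "hybrid_bin x t i M w' m = hybrid_bin x t i (Suc M) w m" if "m < M" for m
      using that by (simp add: hybrid_bin_less w'_def ball_bin_resample)
    have split: "(\<Sum>k<m. f k) = f M + (\<Sum>k\<in>{..<m} - {M}. f k)" if "M < m" for m and f :: "nat \<Rightarrow> nat"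
      using that by (intro sum.remove) auto
    \<comment> \<open>From here on both systems hold one ball in \<open>?J\<close> that dies at
      \<open>?T M + ?s\<close> and one in \<open>?J'\<close> that dies at \<open>?r\<close>; only
      the names of the two are exchanged. So the sums are split at \<open>k = M\<close> and the
      other terms agree by induction.\<close>
    have gt: "hybrid_bin x t i M w' m = hybrid_bin x t i (Suc M) w m" if "M < m" for m
      using that
    proof (induction m rule: less_induct)
      case (less m)
      have IH: "hybrid_bin x t i M w' k = hybrid_bin x t i (Suc M) w k" if "k < m" "k \<noteq> M" for k
        using less lt that by (cases "k < M") auto
      define C where "C j' = (\<Sum>k\<in>{..<m} - {M}.
         of_bool (hybrid_bin x t i (Suc M) w k = j' \<and> ?T m < ?T k + lifetime w k) :: nat)" for j'
      have "(\<Sum>k\<in>{..<m} - {M}. of_bool (hybrid_bin x t i M w' k = j' \<and> ?T m < ?T k + lifetime w' k)) = C j'" for j'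
        unfolding C_def by (rule sum.cong) (auto simp: IH)
      then have 1: "(\<Sum>k<m. of_bool (hybrid_bin x t i M w' k = j' \<and> ?T m < ?T k + lifetime w' k)) =
          of_bool (?J' = j' \<and> ?T m < ?r) + C j'" for j'
        by (subst split[OF less.prems]) (simp add: q del: extra_bin.simps)
      have 2: "(\<Sum>k<m. of_bool (hybrid_bin x t i (Suc M) w k = j' \<and> ?T m < ?T k + lifetime w k)) =
          of_bool (?J = j' \<and> ?T m < ?T M + ?s) + C j'" for j'
        unfolding C_def by (subst split[OF less.prems]) (simp add: b del: extra_bin.simps)
      show ?case
        using less.prems
        by (subst (1 2) hybrid_bin.simps, unfold \<open>arrival w' = ?T\<close> 1 2)
          (auto simp del: extra_bin.simps intro!: arg_cong2[where f = arg_min_list] ext)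
    qed
    let ?A = "\<lambda>m. hybrid_bin x t i M w' m = j \<and> ?T m \<le> t \<and> t < ?T m + lifetime w' m"
    let ?B = "\<lambda>m. hybrid_bin x t i (Suc M) w m = j \<and> ?T m \<le> t \<and> t < ?T m + lifetime w m"
    have eq: "?A m = ?B m" if "m \<noteq> M" for m
      using lt[of m] gt[of m] that by (cases "m < M") auto
    have fin: "finite {m. Q m \<and> ?T m \<le> t \<and> R m}" for Q R
      by (rule finite_subset[where B = "{m. ?T m \<le> t}"]) (use assms in \<open>auto simp: regular_def\<close>)
    have card: "card (Collect Q) = card {m. m \<noteq> M \<and> Q m} + of_bool (Q M)" if "finite (Collect Q)" for Q
    proof -
      have "Collect Q = (if Q M then insert M {m. m \<noteq> M \<and> Q m} else {m. m \<noteq> M \<and> Q m})"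
        by (auto split: if_splits)
      then show ?thesis
        using that by (auto split: if_splits)
    qed
    define nA nB where "nA = card (Collect ?A)" and "nB = card (Collect ?B)"
    have "card {m. m \<noteq> M \<and> ?A m} = card {m. m \<noteq> M \<and> ?B m}"
      using eq by (intro arg_cong[where f = card]) blast
    \<comment> \<open>Only index \<open>M\<close> can be counted differently; the extra ball's own
      term in \<open>hybrid_load\<close> makes up for it.\<close>
    then have "nA + of_bool (?B M) = nB + of_bool (?A M)"
      using card[of ?A, OF fin] card[of ?B, OF fin] unfolding nA_def nB_def by linarith
    moreover have "?A M \<longleftrightarrow> ?J' = j \<and> t < ?r" "?B M \<longleftrightarrow> ?J = j \<and> t < ?T M + ?s"
      using swap q b by (auto simp del: extra_bin.simps)
    moreover have "hybrid_load x t i M w' j = initial_load x w t j + of_bool (j = ?J \<and> t < ?T M + ?s) + nA"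
      by (simp add: hybrid_load_def nA_def)
    moreover have "hybrid_load x t i (Suc M) w j = initial_load x w t j + of_bool (j = ?J' \<and> t < ?r) + nB"
      by (simp only: hybrid_load_def nB_def)
    ultimately show ?thesis
      unfolding * by (simp add: eq_commute[of j] del: extra_bin.simps)
  qed
qed

lemma initial_load_update:
  assumes "i < length x"
  shows "initial_load (x[i := Suc (x ! i)]) w u j =
    initial_load x w u j + of_bool (j = i \<and> u < extra_lifetime x i w)"
proof (cases "j = i")
  case True
  have "{k. k < Suc (x ! i) \<and> u < fst w (i, k)} =
      {k. k < x ! i \<and> u < fst w (i, k)} \<union> (if u < extra_lifetime x i w then {x ! i} else {})"
    by (auto simp: extra_lifetime_def less_Suc_eq)
  with True assms show ?thesis
    by (auto simp: initial_load_def)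
qed (use assms in \<open>auto simp: initial_load_def\<close>)

lemma hybrid_load_0:
  assumes "i < length x"
  shows "hybrid_load x t i 0 w j = load (x[i := Suc (x ! i)]) w t j"
proof -
  have "hybrid_bin x t i 0 w m = ball_bin (x[i := Suc (x ! i)]) w m" for m
  proof (induction m rule: less_induct)
    case (less m)
    then show ?case
      by (subst hybrid_bin.simps, subst ball_bin.simps)
        (auto simp: initial_load_update[OF assms] intro!: arg_cong2[where f = arg_min_list] sum.cong ext)
  qed
  then show ?thesis
    by (simp add: hybrid_load_def load_def initial_load_update[OF assms])
qed

text \<open>The other end of the chain of hybrids: when the second-class period extends past
  \<open>t\<close> and the extra ball is dead at \<open>t\<close>, only the smaller system is
  visible.\<close>

lemma hybrid_load_final:
  assumes "regular w" and "t < arrival w M" and "extra_lifetime x i w \<le> t"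
  shows "hybrid_load x t i M w j = load x w t j"
proof -
  have "m < M" if "arrival w m \<le> t" for m
    using regular_arrival_mono[OF assms(1), of M m] that assms(2) by linarith
  then have "{m. hybrid_bin x t i M w m = j \<and> arrival w m \<le> t \<and> t < arrival w m + lifetime w m} =
      {m. ball_bin x w m = j \<and> arrival w m \<le> t \<and> t < arrival w m + lifetime w m}"
    by (auto simp: hybrid_bin_less)
  with assms(3) show ?thesis
    by (simp add: hybrid_load_def load_def)
qed

section \<open>Measurability\<close>

lemma pred_le_nat:
  fixes f g :: "'a \<Rightarrow> nat"
  assumes [measurable]: "f \<in> measurable M (count_space UNIV)" "g \<in> measurable M (count_space UNIV)"
  shows "Measurable.pred M (\<lambda>w. f w \<le> g w)"
  by (rule measurable_compose_countable[where f = "\<lambda>k w. k \<le> g w" and g = f]) measurable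

lemma measurable_of_bool_count_space [measurable (raw)]:
  "Measurable.pred M P \<Longrightarrow> (\<lambda>w. of_bool (P w)) \<in> measurable M (count_space UNIV)"
  unfolding of_bool_def by measurable

lemma measurable_sum_of_bool [measurable (raw)]:
  fixes N :: nat
  assumes [measurable]: "\<And>k. Measurable.pred M (P k)"
  shows "(\<lambda>w. \<Sum>k<N. of_bool (P k w) :: nat) \<in> measurable M (count_space UNIV)"
proof -
  have "(\<lambda>w. card {k. k < N \<and> P k w}) \<in> measurable M (count_space UNIV)"
  proof (rule measurable_card)
    show "{w \<in> space M. k \<in> {k. k < N \<and> P k w}} \<in> sets M" for k
      by simp
  qed
  also have "(\<lambda>w. card {k. k < N \<and> P k w}) = (\<lambda>w. \<Sum>k<N. of_bool (P k w))"
    by (auto simp: Int_def lessThan_def)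
  finally show ?thesis .
qed

lemma pred_eq_nat:
  fixes f g :: "'a \<Rightarrow> nat"
  assumes [measurable]: "f \<in> measurable M (count_space UNIV)" "g \<in> measurable M (count_space UNIV)"
  shows "Measurable.pred M (\<lambda>w. f w = g w)"
  by (rule measurable_compose_countable[where f = "\<lambda>k w. k = g w" and g = f]) measurable

lemma measurable_add_nat [measurable (raw)]:
  fixes f g :: "'a \<Rightarrow> nat"
  assumes [measurable]: "f \<in> measurable M (count_space UNIV)" "g \<in> measurable M (count_space UNIV)"
  shows "(\<lambda>w. f w + g w) \<in> measurable M (count_space UNIV)"
  by (rule measurable_compose_countable[where f = "\<lambda>k w. k + g w" and g = f]) measurable

text \<open>The list is fixed here. A random list of choices takes countably many values, so
  \<open>measurable_compose_countable\<close> reduces it to this case.\<close>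

lemma measurable_arg_min_list:
  assumes "\<And>j. (\<lambda>w. F w j) \<in> measurable M (count_space (UNIV :: nat set))"
  shows "(\<lambda>w. arg_min_list (F w) c) \<in> measurable M (count_space (UNIV :: nat set))"
proof (induction c rule: induct_list012)
  case 1
  \<comment> \<open>The unspecified value at the empty list is the same for all \<open>f\<close>,
    hence measurable as a constant.\<close>
  have "arg_min_list f [] = undefined" for f :: "nat \<Rightarrow> nat"
    by (rule arg_min_list.elims[OF refl, of f "[]"]) auto
  then show ?case by simp
next
  case (3 x y zs)
  note [measurable] = assms 3
  have [measurable]: "(\<lambda>w. F w (arg_min_list (F w) (y # zs))) \<in> measurable M (count_space UNIV)"
    by (rule measurable_compose_countable) measurable
  have "Measurable.pred M (\<lambda>w. F w x \<le> F w (arg_min_list (F w) (y # zs)))"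
    by (rule pred_le_nat) measurable
  with 3 show ?case
    by (simp add: Let_def measurable_If)
qed simp

lemma measurable_map_upt:
  assumes "\<And>j. (\<lambda>w. F w j) \<in> measurable M (count_space (UNIV :: nat set))"
  shows "(\<lambda>w. map (F w) xs) \<in> measurable M (count_space UNIV)"
proof (induction xs)
  case (Cons j xs)
  note [measurable] = assms Cons
  have "(\<lambda>w. (\<lambda>u. F w j # u) (map (F w) xs)) \<in> measurable M (count_space UNIV)"
    by (rule measurable_compose_countable[OF _ Cons]) measurable
  then show ?case by simp
qed simp

section \<open>The probability space as a product, and measurability of the process on it\<close>

lemma sets_exponential [measurable_cong, simp]: "sets (exponential l) = sets borel"
  by (simp add: exponential_def)

lemma space_exponential [simp]: "space (exponential l) = UNIV"
  by (simp add: exponential_def)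

lemma prob_space_exponential: "0 < l \<Longrightarrow> prob_space (exponential l)"
  unfolding exponential_def by (rule prob_space_exponential_density)

abbreviation marks :: "real \<Rightarrow> nat \<Rightarrow> nat \<Rightarrow> (real \<times> nat list \<times> real) measure" where
  "marks lam d n \<equiv>
     exponential (lam * real n) \<Otimes>\<^sub>M (measure_pmf (choices_pmf d n) \<Otimes>\<^sub>M exponential 1)"

lemma (in pair_prob_space) AE_pair_fst:
  assumes "AE x in M1. P x"
  shows "AE q in M1 \<Otimes>\<^sub>M M2. P (fst q)"
proof -
  have "AE x in distr (M1 \<Otimes>\<^sub>M M2) M1 fst. P x"
    unfolding M2.distr_pair_fst by (rule assms)
  then show ?thesis
    by (rule AE_distrD[OF measurable_fst])
qed

lemma (in pair_prob_space) AE_pair_snd: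
  assumes "AE x in M2. P x"
  shows "AE q in M1 \<Otimes>\<^sub>M M2. P (snd q)"
proof -
  interpret swapped: pair_sigma_finite M2 M1 ..
  have "AE x in distr (M2 \<Otimes>\<^sub>M M1) M2 fst. P x"
    unfolding M1.distr_pair_fst by (rule assms)
  then have "AE q in M2 \<Otimes>\<^sub>M M1. P (fst q)"
    by (rule AE_distrD[OF measurable_fst])
  then have "AE q in M1 \<Otimes>\<^sub>M M2. P (fst (case q of (x, y) \<Rightarrow> (y, x)))"
    by (subst (asm) swapped.distr_pair_swap) (rule AE_distrD[OF measurable_pair_swap'])
  then show ?thesis
    by (simp add: split_beta')
qed

locale bins =
  fixes lam :: real and d n :: nat
  assumes lam_pos: "0 < lam" and d_pos: "0 < d" and n_pos: "0 < n"
begin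

abbreviation "W \<equiv> outcomes lam d n"
abbreviation "Q \<equiv> marks lam d n"
abbreviation "R \<equiv> \<Pi>\<^sub>M i\<in>(UNIV :: (nat \<times> nat) set). exponential 1"
abbreviation "S \<equiv> \<Pi>\<^sub>M m\<in>(UNIV :: nat set). Q"
abbreviation "E \<equiv> exponential 1"

lemma rate_pos: "0 < lam * real n"
  using lam_pos n_pos by simp

sublocale E: prob_space E by (rule prob_space_exponential) simp
sublocale G: prob_space "exponential (lam * real n)" by (rule prob_space_exponential[OF rate_pos])
sublocale C: prob_space "measure_pmf (choices_pmf d n)" by (rule measure_pmf.prob_space_axioms)
sublocale CE: pair_prob_space "measure_pmf (choices_pmf d n)" E ..
sublocale Q: pair_prob_space "exponential (lam * real n)" "measure_pmf (choices_pmf d n) \<Otimes>\<^sub>M E" ..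
sublocale R: prob_space R by (rule prob_space_PiM) (rule E.prob_space_axioms)
sublocale seq: sequence_space Q
  by unfold_locales
sublocale RS: pair_prob_space R S ..

lemma outcomes_eq: "W = R \<Otimes>\<^sub>M S"
  by (simp add: outcomes_def)

lemma sets_W [measurable_cong]: "sets W = sets (R \<Otimes>\<^sub>M S)"
  by (simp add: outcomes_def)

lemma space_R [simp]: "space R = UNIV"
  by (simp add: space_PiM)

lemma space_S [simp]: "space S = UNIV"
  by (simp add: space_PiM space_pair_measure)

lemma space_W [simp]: "space W = UNIV"
  by (simp add: outcomes_def space_pair_measure)

sublocale W: prob_space W
  unfolding outcomes_eq by (rule RS.prob_space_axioms)

lemma measurable_lifetime [measurable]: "(\<lambda>w. lifetime w m) \<in> borel_measurable W"
  unfolding lifetime_def by measurable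

lemma measurable_choices [measurable]: "(\<lambda>w. choices w m) \<in> measurable W (count_space UNIV)"
  unfolding choices_def by measurable

lemma measurable_arrival [measurable]: "(\<lambda>w. arrival w m) \<in> borel_measurable W"
  unfolding arrival_def by measurable

lemma measurable_initial_load [measurable]:
  assumes [measurable]: "T \<in> borel_measurable W"
  shows "(\<lambda>w. initial_load x w (T w) j) \<in> measurable W (count_space UNIV)"
  unfolding initial_load_def by (intro measurable_card) measurable

lemma measurable_ball_bin [measurable]:
  "(\<lambda>w. ball_bin x w m) \<in> measurable W (count_space UNIV)"
proof (induction m rule: less_induct)
  case (less m)
  note [measurable] = this
  show ?case
    unfolding ball_bin.simps[of _ _ m]
    by (rule measurable_compose_countable[OF measurable_arg_min_list measurable_choices]) measurable
qed

lemma measurable_load [measurable]: "(\<lambda>w. load x w t j) \<in> measurable W (count_space UNIV)"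
  unfolding load_def by measurable

lemma measurable_load_vector [measurable]: "load_vector m x t \<in> measurable W (count_space UNIV)"
  unfolding load_vector_def[abs_def] by (intro measurable_map_upt) measurable

lemma measurable_load_before [measurable]:
  "(\<lambda>w. load_before x w m j) \<in> measurable W (count_space UNIV)"
  unfolding load_before_def by measurable

lemma measurable_extra_lifetime [measurable]: "extra_lifetime x i \<in> borel_measurable W"
  unfolding extra_lifetime_def[abs_def] by measurable

lemma measurable_extra_bin [measurable]:
  "(\<lambda>w. extra_bin x t i w m) \<in> measurable W (count_space UNIV)"
proof (induction m)
  case (Suc m)
  note [measurable] = this
  have [measurable]: "(\<lambda>w. arg_min_list (\<lambda>j. load_before x w m j + of_bool (j = extra_bin x t i w m))
      (choices w m)) \<in> measurable W (count_space UNIV)"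
    by (rule measurable_compose_countable[OF measurable_arg_min_list measurable_choices]) measurable
  have [measurable]: "Measurable.pred W (\<lambda>w. ball_bin x w m = extra_bin x t i w m)"
    by (rule pred_eq_nat) measurable
  show ?case
    unfolding extra_bin.simps by (intro measurable_If Suc) measurable
qed simp

lemma measurable_hybrid_bin [measurable]:
  "(\<lambda>w. hybrid_bin x t i M w m) \<in> measurable W (count_space UNIV)"
proof (induction m rule: less_induct)
  case (less m)
  note [measurable] = this
  have [measurable]: "(\<lambda>w. arg_min_list
       (\<lambda>j. initial_load x w (arrival w m) j +
            of_bool (j = extra_bin x t i w M \<and> arrival w m < extra_lifetime x i w) +
            (\<Sum>k<m. of_bool (hybrid_bin x t i M w k = j \<and> arrival w m < arrival w k + lifetime w k)))
       (choices w m)) \<in> measurable W (count_space UNIV)"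
    by (rule measurable_compose_countable[OF measurable_arg_min_list measurable_choices]) measurable
  show ?case
    unfolding hybrid_bin.simps[of _ _ _ _ _ m] by measurable
qed

lemma measurable_hybrid_load [measurable]:
  "(\<lambda>w. hybrid_load x t i M w j) \<in> measurable W (count_space UNIV)"
  unfolding hybrid_load_def by measurable

lemma measurable_swappable [measurable]: "Measurable.pred W (swappable x t i M)"
proof -
  have [measurable]: "Measurable.pred W (\<lambda>w. ball_bin x w M = extra_bin x t i w M)"
    by (rule pred_eq_nat) measurable
  show ?thesis
    unfolding swappable_def[abs_def] by measurable
qed

lemma measurable_resample:
  "(\<lambda>(w, y, z). resample x i M w y z) \<in> measurable (W \<Otimes>\<^sub>M (borel \<Otimes>\<^sub>M borel)) W"
  unfolding resample_def outcomes_eq split_beta'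
  by (intro measurable_Pair measurable_fun_upd[where J = UNIV]) (simp_all, measurable)

lemma measurable_swap [measurable]: "swap x t i M \<in> measurable W W"
proof -
  have "(\<lambda>w. (\<lambda>(w, y, z). resample x i M w y z)
      (w, arrival w M + lifetime w M, extra_lifetime x i w - arrival w M)) \<in> measurable W W"
    by (rule measurable_compose[OF _ measurable_resample]) measurable
  then have [measurable]: "(\<lambda>w. resample x i M w (arrival w M + lifetime w M)
      (extra_lifetime x i w - arrival w M)) \<in> measurable W W"
    by simp
  show ?thesis
    unfolding swap_def[abs_def] by measurable
qed

lemma AE_regular_marks:
  "AE w in W. \<forall>m. 0 \<le> fst (snd w m) \<and> 0 < lifetime w m \<and> choices w m \<noteq> [] \<and> set (choices w m) \<subseteq> {..<n}"
proof -
  have exp_pos: "AE s in exponential l. 0 < s" if "0 < l" for l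
  proof -
    have "AE s in lborel. s \<noteq> (0::real)" by (rule AE_lborel_singleton)
    then show ?thesis
      unfolding exponential_def by (subst AE_density) (auto simp: exponential_density_def)
  qed
  have c: "AE c in measure_pmf (choices_pmf d n). c \<noteq> [] \<and> set c \<subseteq> {..<n}"
    using d_pos n_pos by (auto simp: AE_measure_pmf_iff choices_pmf_def set_replicate_pmf lessThan_empty_iff)
  have "AE q in Q. 0 < fst q"
    by (rule Q.AE_pair_fst[OF exp_pos[OF rate_pos]])
  moreover have "AE q in Q. fst (snd q) \<noteq> [] \<and> set (fst (snd q)) \<subseteq> {..<n}"
    by (rule Q.AE_pair_snd[OF CE.AE_pair_fst[OF c]])
  moreover have "AE q in Q. 0 < snd (snd q)"
    by (rule Q.AE_pair_snd[OF CE.AE_pair_snd[OF exp_pos]]) simp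
  ultimately have "AE q in Q. 0 \<le> fst q \<and> 0 < snd (snd q) \<and> fst (snd q) \<noteq> [] \<and> set (fst (snd q)) \<subseteq> {..<n}"
    by eventually_elim simp
  then have "AE a in S. \<forall>m. 0 \<le> fst (a m) \<and> 0 < snd (snd (a m)) \<and> fst (snd (a m)) \<noteq> [] \<and>
      set (fst (snd (a m))) \<subseteq> {..<n}"
    unfolding AE_all_countable by (intro allI seq.AE_component[rotated]) auto
  then have "AE w in W. \<forall>m. 0 \<le> fst (snd w m) \<and> 0 < snd (snd (snd w m)) \<and> fst (snd (snd w m)) \<noteq> [] \<and>
      set (fst (snd (snd w m))) \<subseteq> {..<n}"
    unfolding outcomes_eq by (rule RS.AE_pair_snd)
  then show ?thesis
    unfolding lifetime_def choices_def .
qed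

end

section \<open>The swap preserves the law\<close>

text \<open>Redrawing one coordinate of an independent family preserves its law: the product measure
  splits into the factor at \<open>k\<close> and the product of the others.\<close>

lemma nn_integral_PiM_resample:
  fixes M :: "'a measure" and k :: 'i
  assumes M: "prob_space M" and f [measurable]: "f \<in> borel_measurable (\<Pi>\<^sub>M i\<in>UNIV. M)"
  shows "(\<integral>\<^sup>+X. \<integral>\<^sup>+y. f (X(k := y)) \<partial>M \<partial>(\<Pi>\<^sub>M i\<in>UNIV. M)) = (\<integral>\<^sup>+X. f X \<partial>(\<Pi>\<^sub>M i\<in>UNIV. M))"
proof -
  interpret M: prob_space M by fact
  let ?I = "UNIV - {k}" and ?P = "\<Pi>\<^sub>M i\<in>(UNIV :: 'i set). M"
  let ?P' = "\<Pi>\<^sub>M i\<in>?I. M"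
  interpret P': prob_space ?P' by (intro prob_space_PiM M)
  interpret MP: pair_sigma_finite M ?P' ..
  have P: "?P = distr (M \<Otimes>\<^sub>M ?P') ?P (\<lambda>(x, X). X(k := x))"
    using distr_pair_PiM_eq_PiM[of ?I "\<lambda>_. M" k] M by (simp add: insert_absorb)
  have upd [measurable]: "(\<lambda>(x, X). X(k := x)) \<in> measurable (M \<Otimes>\<^sub>M ?P') ?P"
    by (auto simp: split_beta' intro!: measurable_fun_upd[where J = ?I])
  have [measurable]: "(\<lambda>(x, X). X(k := x)) \<in> measurable (M \<Otimes>\<^sub>M ?P) ?P"
    by (auto simp: split_beta' intro!: measurable_fun_upd[where J = UNIV])
  have *: "(\<integral>\<^sup>+X. g X \<partial>?P) = (\<integral>\<^sup>+X. \<integral>\<^sup>+y. g (X(k := y)) \<partial>M \<partial>?P')"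
    if g [measurable]: "g \<in> borel_measurable ?P" for g
  proof -
    have [measurable]: "(\<lambda>(x, X). g (X(k := x))) \<in> borel_measurable (M \<Otimes>\<^sub>M ?P')"
      using measurable_compose[OF upd g] by (simp add: split_beta')
    have "(\<integral>\<^sup>+X. g X \<partial>?P) = (\<integral>\<^sup>+q. g ((\<lambda>(x, X). X(k := x)) q) \<partial>(M \<Otimes>\<^sub>M ?P'))"
      by (subst P, subst nn_integral_distr) auto
    also have "\<dots> = (\<integral>\<^sup>+X. \<integral>\<^sup>+y. g (X(k := y)) \<partial>M \<partial>?P')"
      by (subst MP.nn_integral_snd[symmetric]) (simp_all add: split_beta')
    finally show ?thesis .
  qed
  have "(\<lambda>(X, y). f (X(k := y))) \<in> borel_measurable (?P \<Otimes>\<^sub>M M)"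
    unfolding split_beta'
    by (rule measurable_compose[OF _ f]) (auto intro!: measurable_fun_upd[where J = UNIV])
  then have [measurable]: "(\<lambda>X. \<integral>\<^sup>+y. f (X(k := y)) \<partial>M) \<in> borel_measurable ?P"
    by (rule M.borel_measurable_nn_integral)
  \<comment> \<open>The splitting \<open>*\<close> is applied on both sides. On the left the
    integrand no longer depends on coordinate \<open>k\<close>, so integrating over that coordinate
    only contributes the total mass 1.\<close>
  show ?thesis
    by (simp add: * M.emeasure_space_1)
qed

section \<open>Lack of memory of the exponential law\<close>

lemma nn_integral_exponential:
  assumes "f \<in> borel_measurable borel"
  shows "(\<integral>\<^sup>+y. f y \<partial>exponential l) = (\<integral>\<^sup>+y. ennreal (exponential_density l y) * f y \<partial>lborel)"
  unfolding exponential_def using assms by (intro nn_integral_density) auto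

lemma exponential_memoryless:
  assumes g [measurable]: "g \<in> borel_measurable borel" and "0 \<le> T"
  shows "(\<integral>\<^sup>+y. (if T < y then g y else 0) \<partial>exponential 1) =
    ennreal (exp (- T)) * (\<integral>\<^sup>+v. g (T + v) \<partial>exponential 1)"
proof -
  let ?e = "\<lambda>y. ennreal (exponential_density 1 y)"
  have "(\<integral>\<^sup>+y. (if T < y then g y else 0) \<partial>exponential 1) =
      (\<integral>\<^sup>+y. ?e y * (if T < y then g y else 0) \<partial>lborel)"
    by (rule nn_integral_exponential) measurable
  also have "\<dots> = (\<integral>\<^sup>+v. ?e (T + v) * (if T < T + v then g (T + v) else 0) \<partial>lborel)"
    by (subst nn_integral_real_affine[where c = 1 and t = T]) (auto intro!: nn_integral_cong)
  also have "\<dots> = (\<integral>\<^sup>+v. ennreal (exp (- T)) * (?e v * g (T + v)) \<partial>lborel)"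
  proof (rule nn_integral_cong_AE)
    have e: "?e (T + v) = ennreal (exp (- T)) * ?e v" if "0 < v" for v
      using that \<open>0 \<le> T\<close> by (simp add: exponential_density_def mult_exp_exp flip: ennreal_mult)
    have z: "?e v = 0" if "v < 0" for v
      using that by (simp add: exponential_density_def)
    \<comment> \<open>At \<open>v = 0\<close> the left side vanishes while the right side may not,
      so the integrands agree only almost everywhere.\<close>
    have "AE v in lborel. v \<noteq> (0 :: real)" by (rule AE_lborel_singleton)
    then show "AE v in lborel. ?e (T + v) * (if T < T + v then g (T + v) else 0) =
        ennreal (exp (- T)) * (?e v * g (T + v))"
      by eventually_elim
        (auto simp: e z mult.assoc not_less)
  qed
  also have "\<dots> = ennreal (exp (- T)) * (\<integral>\<^sup>+v. g (T + v) \<partial>exponential 1)"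
    by (subst nn_integral_cmult) (auto simp: nn_integral_exponential)
  finally show ?thesis .
qed

text \<open>By lack of memory, \<open>y - T\<close> and \<open>z\<close> are exchangeable given \<open>T < y\<close>.\<close>

lemma exponential_swap:
  assumes F [measurable]: "(\<lambda>(y, z). F y z) \<in> borel_measurable (borel \<Otimes>\<^sub>M borel)" and "0 \<le> T"
  shows "(\<integral>\<^sup>+y. \<integral>\<^sup>+z. (if T < y then F (T + z) (y - T) else F y z) \<partial>exponential 1 \<partial>exponential 1) =
    (\<integral>\<^sup>+y. \<integral>\<^sup>+z. F y z \<partial>exponential 1 \<partial>exponential 1)"
proof -
  let ?E = "exponential 1"
  interpret E: prob_space ?E by (rule prob_space_exponential) simp
  interpret EE: pair_sigma_finite ?E ?E ..
  have F': "(\<lambda>q. F (a q) (b q)) \<in> borel_measurable N"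
    if "a \<in> borel_measurable N" "b \<in> borel_measurable N" for a b and N :: "(real \<times> real) measure"
    using measurable_compose[OF measurable_Pair[OF that] F] by simp
  have F2: "(\<lambda>(v, z). F (T + z) v) \<in> borel_measurable (?E \<Otimes>\<^sub>M ?E)"
    unfolding split_beta' by (rule F'; measurable)
  have split: "(\<integral>\<^sup>+y. (if T < y then f y else g y) \<partial>?E) =
      (\<integral>\<^sup>+y. (if T < y then f y else 0) \<partial>?E) + (\<integral>\<^sup>+y. (if T < y then 0 else g y) \<partial>?E)"
    if [measurable]: "f \<in> borel_measurable borel" "g \<in> borel_measurable borel" for f g :: "real \<Rightarrow> ennreal"
    by (subst nn_integral_add[symmetric]) (auto intro!: nn_integral_cong)
  let ?f = "\<lambda>y. \<integral>\<^sup>+z. F (T + z) (y - T) \<partial>?E" and ?g = "\<lambda>y. \<integral>\<^sup>+z. F y z \<partial>?E"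
  have "(\<lambda>(y, z). F (T + z) (y - T)) \<in> borel_measurable (borel \<Otimes>\<^sub>M ?E)"
    unfolding split_beta' by (rule F'; measurable)
  then have f [measurable]: "?f \<in> borel_measurable borel"
    by (rule E.borel_measurable_nn_integral)
  have "(\<lambda>(y, z). F y z) \<in> borel_measurable (borel \<Otimes>\<^sub>M ?E)"
    unfolding split_beta' by (rule F'; measurable)
  then have g [measurable]: "?g \<in> borel_measurable borel"
    by (rule E.borel_measurable_nn_integral)
  have "(\<integral>\<^sup>+y. (if T < y then ?f y else 0) \<partial>?E) = ennreal (exp (- T)) * (\<integral>\<^sup>+v. \<integral>\<^sup>+z. F (T + z) v \<partial>?E \<partial>?E)"
    by (subst exponential_memoryless[OF f \<open>0 \<le> T\<close>]) simp
  \<comment> \<open>Given \<open>T < y\<close>, the excess \<open>v = y - T\<close> has the same law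
    as \<open>z\<close>, so Fubini's theorem is all that the exchange requires; lack of memory is
    then applied backwards.\<close>
  also have "(\<integral>\<^sup>+v. \<integral>\<^sup>+z. F (T + z) v \<partial>?E \<partial>?E) = (\<integral>\<^sup>+z. \<integral>\<^sup>+v. F (T + z) v \<partial>?E \<partial>?E)"
    by (rule EE.Fubini'[OF F2, symmetric])
  also have "ennreal (exp (- T)) * \<dots> = (\<integral>\<^sup>+y. (if T < y then ?g y else 0) \<partial>?E)"
    by (subst exponential_memoryless[OF g \<open>0 \<le> T\<close>]) simp
  finally have eq: "(\<integral>\<^sup>+y. (if T < y then ?f y else 0) \<partial>?E) = (\<integral>\<^sup>+y. (if T < y then ?g y else 0) \<partial>?E)" .
  have "(\<integral>\<^sup>+y. \<integral>\<^sup>+z. (if T < y then F (T + z) (y - T) else F y z) \<partial>?E \<partial>?E) =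
      (\<integral>\<^sup>+y. (if T < y then ?f y else ?g y) \<partial>?E)"
    by (intro nn_integral_cong) simp
  also have "\<dots> = (\<integral>\<^sup>+y. (if T < y then ?g y else ?g y) \<partial>?E)"
    by (subst (1 2) split[OF _ g]) (simp_all only: eq f g)
  finally show ?thesis by simp
qed

context bins begin

section \<open>Redrawing the two lifetimes in the outcome space\<close>

lemma nn_integral_resample_initial:
  assumes f [measurable]: "f \<in> borel_measurable W"
  shows "(\<integral>\<^sup>+w. \<integral>\<^sup>+y. f ((fst w)(k := y), snd w) \<partial>E \<partial>W) = (\<integral>\<^sup>+w. f w \<partial>W)"
proof -
  have upd: "(\<lambda>(w, y). ((fst w)(k := y), snd w)) \<in> measurable (W \<Otimes>\<^sub>M E) W"
    unfolding outcomes_eq split_beta'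
    by (intro measurable_Pair measurable_fun_upd[where J = UNIV]) (simp_all, measurable)
  have g: "(\<lambda>w. \<integral>\<^sup>+y. f ((fst w)(k := y), snd w) \<partial>E) \<in> borel_measurable (R \<Otimes>\<^sub>M S)"
    using measurable_compose[OF upd f] 
    by (intro E.borel_measurable_nn_integral) (simp add: split_beta' outcomes_eq)
  have fa: "(\<lambda>r. f (r, a)) \<in> borel_measurable R" for a
    using f by (simp add: outcomes_eq)
  have f': "f \<in> borel_measurable (R \<Otimes>\<^sub>M S)"
    using f by (simp add: outcomes_eq)
  have "(\<integral>\<^sup>+w. \<integral>\<^sup>+y. f ((fst w)(k := y), snd w) \<partial>E \<partial>W) = (\<integral>\<^sup>+a. \<integral>\<^sup>+r. \<integral>\<^sup>+y. f (r(k := y), a) \<partial>E \<partial>R \<partial>S)"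
    unfolding outcomes_eq by (subst RS.nn_integral_snd[symmetric]) (use g in \<open>auto simp: split_beta'\<close>)
  also have "\<dots> = (\<integral>\<^sup>+a. \<integral>\<^sup>+r. f (r, a) \<partial>R \<partial>S)"
    by (intro nn_integral_cong nn_integral_PiM_resample fa E.prob_space_axioms)
  also have "\<dots> = (\<integral>\<^sup>+w. f w \<partial>W)"
    unfolding outcomes_eq by (subst RS.nn_integral_snd[symmetric]) (use f' in auto)
  finally show ?thesis .
qed

lemma nn_integral_Q:
  assumes [measurable]: "h \<in> borel_measurable Q"
  shows "(\<integral>\<^sup>+q. h q \<partial>Q) = (\<integral>\<^sup>+g. \<integral>\<^sup>+c. \<integral>\<^sup>+z. h (g, c, z) \<partial>E \<partial>measure_pmf (choices_pmf d n) \<partial>exponential (lam * real n))"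
proof -
  have "(\<integral>\<^sup>+q. h q \<partial>Q) = (\<integral>\<^sup>+g. \<integral>\<^sup>+q. h (g, q) \<partial>(measure_pmf (choices_pmf d n) \<Otimes>\<^sub>M E) \<partial>exponential (lam * real n))"
    by (rule CE.nn_integral_fst[symmetric]) measurable
  also have "\<dots> = (\<integral>\<^sup>+g. \<integral>\<^sup>+c. \<integral>\<^sup>+z. h (g, c, z) \<partial>E \<partial>measure_pmf (choices_pmf d n) \<partial>exponential (lam * real n))"
    by (intro nn_integral_cong E.nn_integral_fst[symmetric]) measurable
  finally show ?thesis .
qed

lemma nn_integral_resample_lifetime:
  assumes f [measurable]: "f \<in> borel_measurable W"
  shows "(\<integral>\<^sup>+w. \<integral>\<^sup>+z. f (fst w, (snd w)(m := (fst (snd w m), fst (snd (snd w m)), z))) \<partial>E \<partial>W) = (\<integral>\<^sup>+w. f w \<partial>W)"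
proof -
  let ?u = "\<lambda>a z. a(m := (fst (a m), fst (snd (a m)), z))"
  have upd: "(\<lambda>(w, z). (fst w, ?u (snd w) z)) \<in> measurable (W \<Otimes>\<^sub>M E) W"
    unfolding outcomes_eq split_beta'
    by (intro measurable_Pair measurable_fun_upd[where J = UNIV]) (simp_all, measurable)
  have g: "(\<lambda>w. \<integral>\<^sup>+z. f (fst w, ?u (snd w) z) \<partial>E) \<in> borel_measurable (R \<Otimes>\<^sub>M S)"
    using measurable_compose[OF upd f] 
    by (intro E.borel_measurable_nn_integral) (simp add: split_beta' outcomes_eq)
  have f' [measurable]: "f \<in> borel_measurable (R \<Otimes>\<^sub>M S)"
    using f by (simp add: outcomes_eq)
  have inner: "(\<integral>\<^sup>+a. \<integral>\<^sup>+z. h (?u a z) \<partial>E \<partial>S) = (\<integral>\<^sup>+a. h a \<partial>S)" if h [measurable]: "h \<in> borel_measurable S" for h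
  proof -
    have u: "(\<lambda>(a, z). ?u a z) \<in> measurable (S \<Otimes>\<^sub>M E) S"
      unfolding split_beta'
      by (intro measurable_fun_upd[where J = UNIV]) (simp_all, measurable)
    have h1: "(\<lambda>a. \<integral>\<^sup>+z. h (?u a z) \<partial>E) \<in> borel_measurable S"
      using measurable_compose[OF u h]
      by (intro E.borel_measurable_nn_integral) (simp add: split_beta')
    have v: "(\<lambda>q. a(m := q)) \<in> measurable Q S" for a
      by (intro measurable_fun_upd[where J = UNIV]) (auto simp: space_PiM space_pair_measure)
    have h2: "(\<lambda>q. h (a(m := q))) \<in> borel_measurable Q" for a
      by (rule measurable_compose[OF v h])
    have v3: "(\<lambda>(q, z). a(m := (fst q, fst (snd q), z))) \<in> measurable (Q \<Otimes>\<^sub>M E) S" for a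
      unfolding split_beta'
      by (intro measurable_fun_upd[where J = UNIV]) (simp_all add: space_PiM space_pair_measure, measurable)
    have h3: "(\<lambda>q. \<integral>\<^sup>+z. h (a(m := (fst q, fst (snd q), z))) \<partial>E) \<in> borel_measurable Q" for a
      using measurable_compose[OF v3 h] 
      by (intro E.borel_measurable_nn_integral) (simp add: split_beta')
    \<comment> \<open>First the whole \<open>m\<close>-th mark is redrawn. Decomposing
      \<open>Q\<close> then shows that the lifetime drawn with it integrates out, and that
      \<open>z\<close> takes its place.\<close>
    have "(\<integral>\<^sup>+a. \<integral>\<^sup>+z. h (?u a z) \<partial>E \<partial>S) =
        (\<integral>\<^sup>+a. \<integral>\<^sup>+q. \<integral>\<^sup>+z. h (a(m := (fst q, fst (snd q), z))) \<partial>E \<partial>Q \<partial>S)"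
      by (subst nn_integral_PiM_resample[OF Q.prob_space_axioms h1, where k = m, symmetric]) simp
    also have "\<dots> = (\<integral>\<^sup>+a. \<integral>\<^sup>+q. h (a(m := q)) \<partial>Q \<partial>S)"
      by (subst nn_integral_Q[OF h3], subst nn_integral_Q[OF h2]) (simp add: E.emeasure_space_1[simplified])
    also have "\<dots> = (\<integral>\<^sup>+a. h a \<partial>S)"
      by (rule nn_integral_PiM_resample[OF Q.prob_space_axioms h])
    finally show ?thesis .
  qed
  have "(\<integral>\<^sup>+w. \<integral>\<^sup>+z. f (fst w, ?u (snd w) z) \<partial>E \<partial>W) = (\<integral>\<^sup>+r. \<integral>\<^sup>+a. \<integral>\<^sup>+z. f (r, ?u a z) \<partial>E \<partial>S \<partial>R)"
    unfolding outcomes_eq by (subst seq.nn_integral_fst[symmetric]) (use g in \<open>auto simp: split_beta'\<close>)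
  also have "\<dots> = (\<integral>\<^sup>+r. \<integral>\<^sup>+a. f (r, a) \<partial>S \<partial>R)"
    by (intro nn_integral_cong inner) measurable
  also have "\<dots> = (\<integral>\<^sup>+w. f w \<partial>W)"
    unfolding outcomes_eq by (subst seq.nn_integral_fst[symmetric]) (use f' in auto)
  finally show ?thesis .
qed

lemma nn_integral_resample:
  assumes f [measurable]: "f \<in> borel_measurable W"
  shows "(\<integral>\<^sup>+w. \<integral>\<^sup>+y. \<integral>\<^sup>+z. f (resample x i M w y z) \<partial>E \<partial>E \<partial>W) = (\<integral>\<^sup>+w. f w \<partial>W)"
proof -
  let ?u = "\<lambda>w z. (fst w, (snd w)(M := (fst (snd w M), fst (snd (snd w M)), z)))"
  have upd: "(\<lambda>(w, z). ?u w z) \<in> measurable (W \<Otimes>\<^sub>M E) W"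
    unfolding outcomes_eq split_beta'
    by (intro measurable_Pair measurable_fun_upd[where J = UNIV]) (simp_all, measurable)
  have g: "(\<lambda>w. \<integral>\<^sup>+z. f (?u w z) \<partial>E) \<in> borel_measurable W"
    using measurable_compose[OF upd f] 
    by (intro E.borel_measurable_nn_integral) (simp add: split_beta')
  show ?thesis
    using nn_integral_resample_initial[OF g, of "(i, x ! i)"] nn_integral_resample_lifetime[OF f, of M]
    by (simp add: resample_def)
qed

text \<open>Both lifetimes are redrawn before the swap is applied, which changes no integral. Given
  the rest of the outcome, \<open>swappable\<close> and the arrival time are then constants, and
  \<open>exponential_swap\<close> treats the two redrawn variables.\<close>

lemma nn_integral_swap:
  assumes f [measurable]: "f \<in> borel_measurable W"
  shows "(\<integral>\<^sup>+w. f (swap x t i M w) \<partial>W) = (\<integral>\<^sup>+w. f w \<partial>W)"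
proof -
  have F: "(\<lambda>(y, z). f (resample x i M w y z)) \<in> borel_measurable (borel \<Otimes>\<^sub>M borel)" for w
    using measurable_compose[OF _ measurable_compose[OF measurable_resample f], of "\<lambda>q. (w, q)"]
    by (simp add: split_beta')
  have "(\<integral>\<^sup>+y. \<integral>\<^sup>+z. f (swap x t i M (resample x i M w y z)) \<partial>E \<partial>E) =
      (\<integral>\<^sup>+y. \<integral>\<^sup>+z. f (resample x i M w y z) \<partial>E \<partial>E)" for w
  proof (cases "swappable x t i M w")
    case True
    have rr: "resample x i M (resample x i M w y z) y' z' = resample x i M w y' z'" for y z y' z'
      by (simp add: resample_def)
    have "f (swap x t i M (resample x i M w y z)) = (if arrival w M < y then
        f (resample x i M w (arrival w M + z) (y - arrival w M)) else f (resample x i M w y z))" for y z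
      using True by (simp add: swap_def rr)
    with True show ?thesis
      by (simp add: exponential_swap[OF F] swappable_def)
  qed (simp add: swap_def)
  then have "(\<integral>\<^sup>+w. \<integral>\<^sup>+y. \<integral>\<^sup>+z. f (swap x t i M (resample x i M w y z)) \<partial>E \<partial>E \<partial>W) = (\<integral>\<^sup>+w. f w \<partial>W)"
    by (simp add: nn_integral_resample)
  then show ?thesis
    by (subst (asm) nn_integral_resample) simp_all
qed

end

section \<open>The number of balls\<close>

text \<open>Unlike \<open>card\<close>, this count is infinite on infinite sets, so a finite mean
  yields almost sure finiteness.\<close>

lemma suminf_of_bool_ennreal:
  "(\<Sum>m. of_bool (P m) :: ennreal) = (if finite {m. P m} then of_nat (card {m. P m}) else \<infinity>)"
proof -
  have "(\<Sum>m. of_bool (P m) :: ennreal) = (\<integral>\<^sup>+m. indicator {m. P m} m \<partial>count_space UNIV)"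
    by (simp add: nn_integral_count_space_nat indicator_def of_bool_def)
  then show ?thesis by simp
qed

text \<open>A squared count is the count plus twice the number of pairs. The later member of a pair
  ranges over all larger indices, beyond \<open>N\<close> as well, so that the inner sum is a
  function of the future of arrival \<open>m\<close>.\<close>

lemma sum_of_bool_square_le:
  "(\<Sum>m<N. of_bool (P m) :: ennreal) ^ 2 \<le> (\<Sum>m<N. of_bool (P m)) +
     2 * (\<Sum>m<N. of_bool (P m) * (\<Sum>k. of_bool (P (Suc m + k))))"
proof (induction N arbitrary: P)
  case (Suc N)
  define p where "p = (of_bool (P 0) :: ennreal)"
  define s where "s = (\<Sum>m<N. of_bool (P (Suc m)) :: ennreal)"
  define r where "r = (\<Sum>m<N. of_bool (P (Suc m)) * (\<Sum>k. of_bool (P (Suc (Suc m + k)))) :: ennreal)"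
  have s: "s ^ 2 \<le> s + 2 * r"
    using Suc[of "\<lambda>m. P (Suc m)"] by (simp add: s_def r_def)
  have "s \<le> (\<Sum>k. of_bool (P (Suc k)))"
    unfolding s_def by (intro sum_le_suminf) auto
  then have ps: "p * s \<le> p * (\<Sum>k. of_bool (P (Suc k)))"
    by (rule mult_left_mono) simp
  have "(p + s) ^ 2 = p + 2 * (p * s) + s ^ 2"
    by (auto simp: p_def power2_eq_square algebra_simps mult_2)
  also have "\<dots> \<le> p + 2 * (p * (\<Sum>k. of_bool (P (Suc k)))) + (s + 2 * r)"
    by (intro add_mono mult_left_mono order.refl ps s) simp
  also have "\<dots> = (p + s) + 2 * (p * (\<Sum>k. of_bool (P (Suc k))) + r)"
    by (simp add: algebra_simps)
  finally show ?case
    unfolding p_def s_def r_def by (simp only: sum.lessThan_Suc_shift o_def) simp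
qed simp

text \<open>The \<open>m\<close>-th arrival time has the Erlang density of index \<open>m\<close>,
  so this is the intensity of the arrivals. It is constant because the Poisson weights of mean
  \<open>l * u\<close> add up to 1.\<close>

lemma suminf_erlang_density:
  assumes "0 < l"
  shows "(\<Sum>m. ennreal (erlang_density m l u)) = ennreal (if u < 0 then 0 else l)"
proof (cases "u < 0")
  case True
  then show ?thesis by (simp add: erlang_density_def)
next
  case False
  have "(\<lambda>m. (l * u) ^ m /\<^sub>R fact m) sums exp (l * u)"
    by (rule exp_converges)
  then have "(\<lambda>m. l * exp (- l * u) * ((l * u) ^ m /\<^sub>R fact m)) sums (l * exp (- l * u) * exp (l * u))"
    by (rule sums_mult)
  moreover have "l * exp (- l * u) * ((l * u) ^ m /\<^sub>R fact m) = erlang_density m l u" for m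
    using False by (simp add: erlang_density_def power_mult_distrib field_simps)
  ultimately have "(\<lambda>m. erlang_density m l u) sums l"
    by (simp add: mult.assoc mult_exp_exp)
  then show ?thesis
    using False assms by (subst suminf_ennreal_eq[where x = l]) auto
qed

section \<open>Regeneration of the marked Poisson process after an arrival\<close>

definition arrival_time :: "(nat \<Rightarrow> real \<times> nat list \<times> real) \<Rightarrow> nat \<Rightarrow> real" where
  "arrival_time a m = (\<Sum>k\<le>m. fst (a k))"

definition mark_lifetime :: "(nat \<Rightarrow> real \<times> nat list \<times> real) \<Rightarrow> nat \<Rightarrow> real" where
  "mark_lifetime a m = snd (snd (a m))"

definition alive :: "real \<Rightarrow> (nat \<Rightarrow> real \<times> nat list \<times> real) \<Rightarrow> nat \<Rightarrow> bool" where
  "alive t a m \<longleftrightarrow> arrival_time a m \<le> t \<and> t < arrival_time a m + mark_lifetime a m"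

lemma arrival_time_add:
  "arrival_time a (Suc m + k) = arrival_time a m + arrival_time (\<lambda>i. a (Suc m + i)) k"
  by (induction k) (simp_all add: arrival_time_def)

text \<open>Regeneration: the marks after arrival \<open>m\<close> form a fresh sequence, observed
  for the remaining time \<open>t - arrival_time a m\<close>. This is why arrivals and lifetimes are
  restated as functions of the marks alone.\<close>

lemma alive_add: "alive t a (Suc m + k) \<longleftrightarrow> alive (t - arrival_time a m) (\<lambda>i. a (Suc m + i)) k"
  by (auto simp: alive_def arrival_time_add mark_lifetime_def simp del: add_Suc)

context bins begin

abbreviation "l \<equiv> lam * real n"

lemma measurable_arrival_time [measurable]: "(\<lambda>a. arrival_time a m) \<in> borel_measurable S"
  unfolding arrival_time_def by measurable

lemma measurable_mark_lifetime [measurable]: "(\<lambda>a. mark_lifetime a m) \<in> borel_measurable S"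
  unfolding mark_lifetime_def by measurable

lemma measurable_shift [measurable]: "(\<lambda>a k. a (Suc m + k)) \<in> measurable S S"
  by (rule measurable_PiM_single') (auto simp: space_PiM space_pair_measure)

lemma measurable_case_nat_S: "(\<lambda>(q, a). case_nat q a) \<in> measurable (Q \<Otimes>\<^sub>M S) S"
  by measurable

lemma nn_integral_S_iter:
  assumes g [measurable]: "g \<in> borel_measurable S"
  shows "(\<integral>\<^sup>+a. g a \<partial>S) = (\<integral>\<^sup>+q. \<integral>\<^sup>+a. g (case_nat q a) \<partial>S \<partial>Q)"
proof -
  have "(\<integral>\<^sup>+a. g a \<partial>S) = (\<integral>\<^sup>+q. g ((\<lambda>(q, a). case_nat q a) q) \<partial>(Q \<Otimes>\<^sub>M S))"
    by (subst seq.PiM_iter[symmetric], subst nn_integral_distr) auto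
  also have "\<dots> = (\<integral>\<^sup>+q. \<integral>\<^sup>+a. g (case_nat q a) \<partial>S \<partial>Q)"
    using measurable_compose[OF measurable_case_nat_S g]
    by (subst seq.nn_integral_fst[symmetric]) simp_all
  finally show ?thesis .
qed

lemma nn_integral_Q_gap:
  assumes [measurable]: "K \<in> borel_measurable borel"
  shows "(\<integral>\<^sup>+q. K (fst q) \<partial>Q) = (\<integral>\<^sup>+g. ennreal (exponential_density l g) * K g \<partial>lborel)"
proof -
  have "(\<integral>\<^sup>+q. K (fst q) \<partial>Q) = (\<integral>\<^sup>+g. K g \<partial>exponential l)"
    by (subst nn_integral_Q) (simp_all add: E.emeasure_space_1[simplified])
  then show ?thesis by (simp add: nn_integral_exponential)
qed

text \<open>An arrival time, the lifetime of its ball and all later marks are independent. The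
  induction splits off the first gap; its exponential density convolved with an Erlang density gives
  the next one.\<close>

lemma nn_integral_arrival:
  assumes "(\<lambda>(u, z, a). h u z a) \<in> borel_measurable (borel \<Otimes>\<^sub>M borel \<Otimes>\<^sub>M S)"
  shows "(\<integral>\<^sup>+a. h (arrival_time a m) (mark_lifetime a m) (\<lambda>k. a (Suc m + k)) \<partial>S) =
    (\<integral>\<^sup>+u. ennreal (erlang_density m l u) * (\<integral>\<^sup>+z. \<integral>\<^sup>+a. h u z a \<partial>S \<partial>E) \<partial>lborel)"
  using assms
proof (induction m arbitrary: h)
  case (0 h)
  have h: "(\<lambda>q. h (x q) (y q) (a q)) \<in> borel_measurable N"
    if "x \<in> borel_measurable N" "y \<in> borel_measurable N" "a \<in> measurable N S" for x y a N
    using measurable_compose[OF measurable_Pair[OF that(1) measurable_Pair[OF that(2,3)]] 0] by simp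
  have 1: "(\<lambda>(q, a). h (fst q) (snd (snd q)) a) \<in> borel_measurable (Q \<Otimes>\<^sub>M S)"
    unfolding split_beta' by (rule h; measurable)
  have 2: "(\<lambda>((g, z), a). h g z a) \<in> borel_measurable ((borel \<Otimes>\<^sub>M E) \<Otimes>\<^sub>M S)"
    unfolding split_beta' by (rule h; measurable)
  have 3: "(\<lambda>(g, z). \<integral>\<^sup>+a. h g z a \<partial>S) \<in> borel_measurable (borel \<Otimes>\<^sub>M E)"
    using seq.borel_measurable_nn_integral[of "\<lambda>q a. h (fst q) (snd q) a"] 2 by (simp add: split_beta')
  have 4: "(\<lambda>g. \<integral>\<^sup>+z. \<integral>\<^sup>+a. h g z a \<partial>S \<partial>E) \<in> borel_measurable borel"
    using 3 by (rule E.borel_measurable_nn_integral)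
  have "(\<integral>\<^sup>+a. h (arrival_time a 0) (mark_lifetime a 0) (\<lambda>k. a (Suc 0 + k)) \<partial>S) =
      (\<integral>\<^sup>+q. \<integral>\<^sup>+a. h (fst q) (snd (snd q)) a \<partial>S \<partial>Q)"
    by (subst nn_integral_S_iter, rule h, rule measurable_arrival_time, rule measurable_mark_lifetime,
        rule measurable_shift) (auto simp: arrival_time_def mark_lifetime_def)
  also have "\<dots> = (\<integral>\<^sup>+g. \<integral>\<^sup>+z. \<integral>\<^sup>+a. h g z a \<partial>S \<partial>E \<partial>exponential l)"
    using seq.borel_measurable_nn_integral[OF 1]
    by (subst nn_integral_Q) (simp_all)
  also have "\<dots> = (\<integral>\<^sup>+u. ennreal (erlang_density 0 l u) * (\<integral>\<^sup>+z. \<integral>\<^sup>+a. h u z a \<partial>S \<partial>E) \<partial>lborel)"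
    using 4 by (rule nn_integral_exponential)
  finally show ?case .
next
  case (Suc m h)
  have h: "(\<lambda>q. h (x q) (y q) (a q)) \<in> borel_measurable N"
    if "x \<in> borel_measurable N" "y \<in> borel_measurable N" "a \<in> measurable N S" for x y a N
    using measurable_compose[OF measurable_Pair[OF that(1) measurable_Pair[OF that(2,3)]] Suc.prems] by simp
  define H where "H u = (\<integral>\<^sup>+z. \<integral>\<^sup>+a. h u z a \<partial>S \<partial>E)" for u
  have "(\<lambda>((g, z), a). h g z a) \<in> borel_measurable ((borel \<Otimes>\<^sub>M E) \<Otimes>\<^sub>M S)"
    unfolding split_beta' by (rule h; measurable)
  then have "(\<lambda>(g, z). \<integral>\<^sup>+a. h g z a \<partial>S) \<in> borel_measurable (borel \<Otimes>\<^sub>M E)"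
    using seq.borel_measurable_nn_integral[of "\<lambda>q a. h (fst q) (snd q) a"] by (simp add: split_beta')
  then have H [measurable]: "H \<in> borel_measurable borel"
    unfolding H_def by (rule E.borel_measurable_nn_integral)
  have hg: "(\<lambda>(u, z, a). h (g + u) z a) \<in> borel_measurable (borel \<Otimes>\<^sub>M borel \<Otimes>\<^sub>M S)" for g
    unfolding split_beta' by (rule h; measurable)
  have shift: "(\<integral>\<^sup>+u. ennreal (erlang_density m l u) * H (g + u) \<partial>lborel) =
      (\<integral>\<^sup>+v. ennreal (erlang_density m l (v - g)) * H v \<partial>lborel)" for g
    by (subst (2) nn_integral_real_affine[where c = 1 and t = g]) (auto intro!: nn_integral_cong)
  have at: "arrival_time (case_nat q a) (Suc m) = fst q + arrival_time a m" for q a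
    unfolding arrival_time_def by (subst sum.atMost_Suc_shift) simp
  have "(\<integral>\<^sup>+a. h (arrival_time a (Suc m)) (mark_lifetime a (Suc m)) (\<lambda>k. a (Suc (Suc m) + k)) \<partial>S) =
      (\<integral>\<^sup>+q. \<integral>\<^sup>+a. h (fst q + arrival_time a m) (mark_lifetime a m) (\<lambda>k. a (Suc m + k)) \<partial>S \<partial>Q)"
    by (subst nn_integral_S_iter, rule h, rule measurable_arrival_time, rule measurable_mark_lifetime,
        rule measurable_shift) (simp add: at, simp add: mark_lifetime_def)
  also have "\<dots> = (\<integral>\<^sup>+q. (\<integral>\<^sup>+u. ennreal (erlang_density m l u) * H (fst q + u) \<partial>lborel) \<partial>Q)"
    unfolding H_def by (intro nn_integral_cong Suc.IH hg)
  also have "\<dots> = (\<integral>\<^sup>+g. ennreal (exponential_density l g) *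
      (\<integral>\<^sup>+u. ennreal (erlang_density m l u) * H (g + u) \<partial>lborel) \<partial>lborel)"
    by (rule nn_integral_Q_gap) measurable
  also have "\<dots> = (\<integral>\<^sup>+g. ennreal (exponential_density l g) *
      (\<integral>\<^sup>+v. ennreal (erlang_density m l (v - g)) * H v \<partial>lborel) \<partial>lborel)"
    by (simp only: shift)
  also have "\<dots> = (\<integral>\<^sup>+g. \<integral>\<^sup>+v. ennreal (erlang_density m l (v - g)) * ennreal (exponential_density l g) * H v
      \<partial>lborel \<partial>lborel)"
    by (subst nn_integral_cmult[symmetric]) (auto simp: mult_ac)
  also have "\<dots> = (\<integral>\<^sup>+v. \<integral>\<^sup>+g. ennreal (erlang_density m l (v - g)) * ennreal (exponential_density l g) * H v
      \<partial>lborel \<partial>lborel)"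
    by (rule lborel_pair.Fubini') measurable
  also have "\<dots> = (\<integral>\<^sup>+v. (\<integral>\<^sup>+g. ennreal (erlang_density m l (v - g)) * ennreal (exponential_density l g) \<partial>lborel) * H v
      \<partial>lborel)"
    by (subst nn_integral_multc) auto
  also have "\<dots> = (\<integral>\<^sup>+v. ennreal (erlang_density (Suc m) l v) * H v \<partial>lborel)"
    using fun_cong[OF convolution_erlang_density[OF rate_pos, of m 0]] by simp
  finally show ?case by (simp add: H_def)
qed

text \<open>Campbell's formula for the marked Poisson process, with the future of each arrival as part of
  its mark.\<close>

lemma campbell:
  assumes "(\<lambda>(u, z, a). h u z a) \<in> borel_measurable (borel \<Otimes>\<^sub>M borel \<Otimes>\<^sub>M S)"
  shows "(\<integral>\<^sup>+a. (\<Sum>m. h (arrival_time a m) (mark_lifetime a m) (\<lambda>k. a (Suc m + k))) \<partial>S) =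
    (\<integral>\<^sup>+u. ennreal l * indicator {0..} u * (\<integral>\<^sup>+z. \<integral>\<^sup>+a. h u z a \<partial>S \<partial>E) \<partial>lborel)"
proof -
  have h: "(\<lambda>q. h (x q) (y q) (a q)) \<in> borel_measurable N"
    if "x \<in> borel_measurable N" "y \<in> borel_measurable N" "a \<in> measurable N S" for x y a N
    using measurable_compose[OF measurable_Pair[OF that(1) measurable_Pair[OF that(2,3)]] assms] by simp
  define H where "H u = (\<integral>\<^sup>+z. \<integral>\<^sup>+a. h u z a \<partial>S \<partial>E)" for u
  have "(\<lambda>((g, z), a). h g z a) \<in> borel_measurable ((borel \<Otimes>\<^sub>M E) \<Otimes>\<^sub>M S)"
    unfolding split_beta' by (rule h; measurable)
  then have "(\<lambda>(g, z). \<integral>\<^sup>+a. h g z a \<partial>S) \<in> borel_measurable (borel \<Otimes>\<^sub>M E)"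
    using seq.borel_measurable_nn_integral[of "\<lambda>q a. h (fst q) (snd q) a"] by (simp add: split_beta')
  then have H [measurable]: "H \<in> borel_measurable borel"
    unfolding H_def by (rule E.borel_measurable_nn_integral)
  have "(\<integral>\<^sup>+a. (\<Sum>m. h (arrival_time a m) (mark_lifetime a m) (\<lambda>k. a (Suc m + k))) \<partial>S) =
      (\<Sum>m. \<integral>\<^sup>+a. h (arrival_time a m) (mark_lifetime a m) (\<lambda>k. a (Suc m + k)) \<partial>S)"
    by (rule nn_integral_suminf, rule h) measurable
  also have "\<dots> = (\<Sum>m. \<integral>\<^sup>+u. ennreal (erlang_density m l u) * H u \<partial>lborel)"
    using nn_integral_arrival[OF assms] by (simp add: H_def)
  also have "\<dots> = (\<integral>\<^sup>+u. (\<Sum>m. ennreal (erlang_density m l u) * H u) \<partial>lborel)"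
    by (rule nn_integral_suminf[symmetric]) measurable
  also have "\<dots> = (\<integral>\<^sup>+u. ennreal l * indicator {0..} u * H u \<partial>lborel)"
    by (intro nn_integral_cong)
      (auto simp: ennreal_suminf_multc suminf_erlang_density[OF rate_pos] indicator_def)
  finally show ?thesis by (simp add: H_def)
qed

text \<open>Campbell's formula weighted by the probability \<open>exp (u - t)\<close> that a ball
  arriving at \<open>u\<close> survives until \<open>t\<close>. The argument \<open>K\<close> is a
  functional of the future; taking the population for it counts pairs of live balls.\<close>

lemma nn_integral_alive:
  assumes K: "(\<lambda>(u, a). K u a) \<in> borel_measurable (borel \<Otimes>\<^sub>M S)"
  shows "(\<integral>\<^sup>+a. (\<Sum>m. of_bool (alive t a m) * K (t - arrival_time a m) (\<lambda>k. a (Suc m + k))) \<partial>S) =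
    (\<integral>\<^sup>+v. ennreal (l * exp (- v)) * indicator {0..t} v * (\<integral>\<^sup>+a. K v a \<partial>S) \<partial>lborel)"
proof -
  define h where "h u z a = of_bool (u \<le> t \<and> t < u + z) * K (t - u) a" for u z :: real and a
  have K': "(\<lambda>q. K (x q) (a q)) \<in> borel_measurable N"
    if "x \<in> borel_measurable N" "a \<in> measurable N S" for x a N
    using measurable_compose[OF measurable_Pair[OF that] K] by simp
  have [measurable]: "(\<lambda>q. K (t - fst q) (snd (snd q))) \<in>
      borel_measurable (borel \<Otimes>\<^sub>M (borel :: real measure) \<Otimes>\<^sub>M S)"
    by (rule K'; measurable)
  have h: "(\<lambda>(u, z, a). h u z a) \<in> borel_measurable (borel \<Otimes>\<^sub>M borel \<Otimes>\<^sub>M S)"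
    unfolding h_def of_bool_def split_beta' by measurable
  define J where "J v = (\<integral>\<^sup>+a. K v a \<partial>S)" for v
  have [measurable]: "J \<in> borel_measurable borel"
    unfolding J_def using K by (rule seq.borel_measurable_nn_integral)
  have 1: "(\<integral>\<^sup>+z. of_bool (u \<le> t \<and> t < u + z) \<partial>E) = ennreal (exp (u - t)) * of_bool (u \<le> t)" for u
  proof (cases "u \<le> t")
    case True
    have "(\<integral>\<^sup>+z. of_bool (u \<le> t \<and> t < u + z) \<partial>E) = (\<integral>\<^sup>+z. (if t - u < z then 1 else 0) \<partial>E)"
      using True by (intro nn_integral_cong) (auto simp: of_bool_def)
    also have "\<dots> = ennreal (exp (- (t - u)))"
      using True by (subst exponential_memoryless) (simp_all add: E.emeasure_space_1[simplified])
    finally show ?thesis using True by simp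
  qed simp
  define G where "G u = ennreal l * indicator {0..} u * (ennreal (exp (u - t)) * of_bool (u \<le> t) * J (t - u))" for u
  have [measurable]: "G \<in> borel_measurable borel"
    unfolding G_def of_bool_def by measurable
  have "(\<integral>\<^sup>+z. \<integral>\<^sup>+a. h u z a \<partial>S \<partial>E) = ennreal (exp (u - t)) * of_bool (u \<le> t) * J (t - u)" for u
  proof -
    have Ku: "(\<lambda>a. K (t - u) a) \<in> borel_measurable S" by (rule K'; measurable)
    have "(\<integral>\<^sup>+z. \<integral>\<^sup>+a. h u z a \<partial>S \<partial>E) = (\<integral>\<^sup>+z. of_bool (u \<le> t \<and> t < u + z) * J (t - u) \<partial>E)"
      unfolding h_def J_def by (intro nn_integral_cong nn_integral_cmult Ku)
    also have "\<dots> = (\<integral>\<^sup>+z. of_bool (u \<le> t \<and> t < u + z) \<partial>E) * J (t - u)"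
      unfolding of_bool_def by (rule nn_integral_multc) measurable
    finally show ?thesis by (simp add: 1)
  qed
  then have "(\<integral>\<^sup>+a. (\<Sum>m. h (arrival_time a m) (mark_lifetime a m) (\<lambda>k. a (Suc m + k))) \<partial>S) =
      (\<integral>\<^sup>+u. ennreal l * indicator {0..} u * (ennreal (exp (u - t)) * of_bool (u \<le> t) * J (t - u)) \<partial>lborel)"
    by (subst campbell[OF h]) simp
  \<comment> \<open>Substitution \<open>v = t - u\<close>, which is both the age of the ball at time
    \<open>t\<close> and the time left to its future.\<close>
  also have "\<dots> = (\<integral>\<^sup>+v. ennreal l * indicator {0..} (t - v) *
      (ennreal (exp (- v)) * of_bool (0 \<le> v) * J v) \<partial>lborel)"
    unfolding G_def[symmetric]
    by (subst nn_integral_real_affine[where c = "-1" and t = t]) (simp_all add: G_def)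
  also have "\<dots> = (\<integral>\<^sup>+v. ennreal (l * exp (- v)) * indicator {0..t} v * J v \<partial>lborel)"
    using rate_pos by (intro nn_integral_cong) (simp only: ennreal_mult exp_ge_zero less_imp_le,
        auto simp: indicator_def mult_ac)
  finally show ?thesis by (simp add: h_def J_def alive_def)
qed

section \<open>First and second moments of the number of live balls\<close>

definition population :: "real \<Rightarrow> (nat \<Rightarrow> real \<times> nat list \<times> real) \<Rightarrow> ennreal" where
  "population t a = (\<Sum>m. of_bool (alive t a m))"

lemma measurable_population: "(\<lambda>(t, a). population t a) \<in> borel_measurable (borel \<Otimes>\<^sub>M S)"
  unfolding population_def alive_def of_bool_def by measurable

lemma measurable_population' [measurable]: "population t \<in> borel_measurable S"
  using measurable_compose[OF _ measurable_population, of "\<lambda>a. (t, a)"] by simp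

definition mean_population :: "real \<Rightarrow> real" where
  "mean_population t = l * (1 - exp (- t))"

lemma mean_population_nonneg: "0 \<le> t \<Longrightarrow> 0 \<le> mean_population t"
  using rate_pos by (simp add: mean_population_def)

lemma nn_integral_population:
  assumes "0 \<le> t"
  shows "(\<integral>\<^sup>+a. population t a \<partial>S) = ennreal (mean_population t)"
proof -
  have "(\<integral>\<^sup>+a. population t a \<partial>S) = (\<integral>\<^sup>+v. ennreal (l * exp (- v)) * indicator {0..t} v \<partial>lborel)"
    using nn_integral_alive[of "\<lambda>_ _. 1" t]
    by (simp add: population_def seq.emeasure_space_1[simplified])
  also have "\<dots> = ennreal (- l * exp (- t) - (- l * exp (- 0)))"
    using assms rate_pos by (intro nn_integral_FTC_Icc) (auto intro!: derivative_eq_intros)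
  finally show ?thesis by (simp add: mean_population_def algebra_simps)
qed

lemma AE_finite_alive:
  assumes "0 \<le> t"
  shows "AE a in S. finite {m. alive t a m}"
proof -
  have "AE a in S. population t a \<noteq> \<infinity>"
    using nn_integral_population[OF assms] by (intro nn_integral_noteq_infinite) auto
  then show ?thesis
    by eventually_elim (auto simp: population_def suminf_of_bool_ennreal split: if_splits)
qed

text \<open>With \<open>m\<close> for \<open>mean_population\<close>, the expected number of pairs
  is the integral of \<open>m' * m\<close> over \<open>{0..t}\<close>, that is, half of
  \<open>m t ^ 2\<close>. So the variance is bounded by the mean without identifying the law of the
  population as Poisson.\<close>

lemma nn_integral_population_square:
  assumes "0 \<le> t"
  shows "(\<integral>\<^sup>+a. population t a ^ 2 \<partial>S) \<le> ennreal (mean_population t + mean_population t ^ 2)"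
proof -
  define X where "X a = (\<Sum>m. of_bool (alive t a m) * population (t - arrival_time a m) (\<lambda>k. a (Suc m + k)))" for a
  have "AE a in S. population t a ^ 2 \<le> population t a + 2 * X a"
    using AE_finite_alive[OF assms]
  proof eventually_elim
    case (elim a)
    \<comment> \<open>Almost surely the series is a finite sum, the form to which
      \<open>sum_of_bool_square_le\<close> applies.\<close>
    then obtain N where N: "\<And>m. alive t a m \<Longrightarrow> m < N"
      by (metis finite_nat_set_iff_bounded mem_Collect_eq)
    have eq: "population t a = (\<Sum>m<N. of_bool (alive t a m))"
      unfolding population_def by (rule suminf_finite) (use N in auto)
    have "(\<Sum>m<N. of_bool (alive t a m) * (\<Sum>k. of_bool (alive t a (Suc m + k)))) \<le> X a"
      unfolding X_def population_def alive_add by (rule sum_le_suminf) auto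
    then show ?case
      unfolding eq by (intro order.trans[OF sum_of_bool_square_le] add_mono mult_left_mono order.refl) simp_all
  qed
  then have "(\<integral>\<^sup>+a. population t a ^ 2 \<partial>S) \<le> (\<integral>\<^sup>+a. population t a + 2 * X a \<partial>S)"
    by (rule nn_integral_mono_AE)
  also have "\<dots> = (\<integral>\<^sup>+a. population t a \<partial>S) + 2 * (\<integral>\<^sup>+a. X a \<partial>S)"
  proof -
    have [measurable]: "X \<in> borel_measurable S"
    proof -
      have [measurable]: "(\<lambda>a. population (t - arrival_time a m) (\<lambda>k. a (Suc m + k))) \<in> borel_measurable S" for m
        using measurable_compose[OF measurable_Pair[OF _ measurable_shift] measurable_population,
            of "\<lambda>a. t - arrival_time a m" m] by simp
      show ?thesis
        unfolding X_def alive_def of_bool_def by measurable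
    qed
    show ?thesis by (simp add: nn_integral_add nn_integral_cmult)
  qed
  also have "(\<integral>\<^sup>+a. X a \<partial>S) = ennreal (mean_population t ^ 2 / 2)"
  proof -
    have "(\<integral>\<^sup>+a. X a \<partial>S) =
        (\<integral>\<^sup>+v. ennreal (l * exp (- v)) * indicator {0..t} v * (\<integral>\<^sup>+a. population v a \<partial>S) \<partial>lborel)"
      unfolding X_def by (rule nn_integral_alive[OF measurable_population])
    also have "\<dots> = (\<integral>\<^sup>+v. ennreal (l * exp (- v) * mean_population v) * indicator {0..t} v \<partial>lborel)"
      using rate_pos by (intro nn_integral_cong)
        (auto simp: indicator_def nn_integral_population ennreal_mult mean_population_nonneg)
    also have "\<dots> = ennreal (mean_population t ^ 2 / 2 - mean_population 0 ^ 2 / 2)"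
    proof (rule nn_integral_FTC_Icc)
      show "(\<lambda>v. l * exp (- v) * mean_population v) \<in> borel_measurable borel"
        unfolding mean_population_def by measurable
      show "DERIV (\<lambda>v. mean_population v ^ 2 / 2) v :> l * exp (- v) * mean_population v" for v
        unfolding mean_population_def by (auto intro!: derivative_eq_intros)
      show "0 \<le> l * exp (- v) * mean_population v" if "v \<in> {0..t}" for v
        using that rate_pos lam_pos by (intro mult_nonneg_nonneg mean_population_nonneg) auto
    qed (rule assms)
    finally show ?thesis by (simp add: mean_population_def)
  qed
  also have "(\<integral>\<^sup>+a. population t a \<partial>S) + 2 * ennreal (mean_population t ^ 2 / 2) =
      ennreal (mean_population t + mean_population t ^ 2)"
    using mean_population_nonneg[OF assms]
    by (simp add: nn_integral_population[OF assms] numeral_mult_ennreal)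
  finally show ?thesis .
qed

text \<open>By Campbell's formula the mean number of arrivals up to a fixed time is finite. Integer
  times suffice by monotonicity and keep the exceptional sets countable in number.\<close>

lemma AE_finite_arrivals: "AE a in S. \<forall>t. finite {m. arrival_time a m \<le> t}"
proof -
  have "AE a in S. finite {m. arrival_time a m \<le> real N}" for N
  proof -
    let ?h = "\<lambda>(u :: real) (z :: real) (a :: nat \<Rightarrow> real \<times> nat list \<times> real). of_bool (u \<le> real N) :: ennreal"
    have "(\<integral>\<^sup>+a. (\<Sum>m. of_bool (arrival_time a m \<le> real N)) \<partial>S) =
        (\<integral>\<^sup>+u. ennreal l * indicator {0..} u * of_bool (u \<le> real N) \<partial>lborel)"
      using campbell[of ?h] by (simp add: E.emeasure_space_1[simplified] seq.emeasure_space_1[simplified])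
    also have "\<dots> = (\<integral>\<^sup>+u. ennreal l * indicator {0..real N} u \<partial>lborel)"
      by (intro nn_integral_cong) (auto simp: indicator_def)
    also have "\<dots> < \<infinity>"
      by (subst nn_integral_cmult_indicator) (auto simp: ennreal_mult_less_top)
    finally have "AE a in S. (\<Sum>m. of_bool (arrival_time a m \<le> real N) :: ennreal) \<noteq> \<infinity>"
      by (intro nn_integral_noteq_infinite) (auto simp: of_bool_def)
    then show ?thesis
      by eventually_elim (auto simp: suminf_of_bool_ennreal split: if_splits)
  qed
  then have "AE a in S. \<forall>N. finite {m. arrival_time a m \<le> real N}"
    by (simp add: AE_all_countable)
  then show ?thesis
  proof eventually_elim
    case (elim a)
    show ?case
    proof
      fix t
      obtain N where "t \<le> real N" using real_arch_simple by blast
      then show "finite {m. arrival_time a m \<le> t}"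
        using elim[rule_format, of N] by (elim rev_finite_subset) auto
    qed
  qed
qed

end

section \<open>The mixing time\<close>

text \<open>The coupling inequality, with null sets allowed for.\<close>

lemma (in prob_space) abs_prob_diff_le:
  assumes AE: "AE w in M. w \<notin> B \<longrightarrow> (P w \<longleftrightarrow> Q w)"
    and [measurable]: "Measurable.pred M P" "Measurable.pred M Q" "B \<in> events"
  shows "\<bar>prob {w \<in> space M. P w} - prob {w \<in> space M. Q w}\<bar> \<le> prob B"
proof -
  have *: "prob {w \<in> space M. P' w} \<le> prob {w \<in> space M. Q' w} + prob B"
    if [measurable]: "Measurable.pred M P'" "Measurable.pred M Q'"
      and "AE w in M. w \<notin> B \<longrightarrow> P' w \<longrightarrow> Q' w" for P' Q'
  proof -
    have "prob {w \<in> space M. P' w} \<le> prob ({w \<in> space M. Q' w} \<union> B)"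
      using that(3) by (intro finite_measure_mono_AE) auto
    also have "\<dots> \<le> prob {w \<in> space M. Q' w} + prob B"
      by (rule measure_Un_le) auto
    finally show ?thesis .
  qed
  have "AE w in M. w \<notin> B \<longrightarrow> P w \<longrightarrow> Q w" "AE w in M. w \<notin> B \<longrightarrow> Q w \<longrightarrow> P w"
    using AE by auto
  then show ?thesis
    using *[of P Q] *[of Q P] by simp
qed

context bins begin

section \<open>Contraction: the effect of one extra ball on the law\<close>

lemma arrival_eq: "arrival w = arrival_time (snd w)"
  by (simp add: fun_eq_iff arrival_def arrival_time_def)

lemma lifetime_eq: "lifetime w = mark_lifetime (snd w)"
  by (simp add: fun_eq_iff lifetime_def mark_lifetime_def)

lemma AE_regular: "AE w in W. regular w"
proof -
  have "AE w in W. \<forall>t. finite {m. arrival w m \<le> t}"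
    unfolding arrival_eq outcomes_eq by (rule RS.AE_pair_snd[OF AE_finite_arrivals])
  with AE_regular_marks show ?thesis
    by eventually_elim (auto simp: regular_def)
qed

lemma sets_W_Collect: "Measurable.pred W P \<Longrightarrow> {w. P w} \<in> sets W"
  by (simp add: pred_def)

lemma prob_load_law: "measure (load_law lam d n x t) A = W.prob {w. load_vector n x t w \<in> A}"
  unfolding load_law_def by (subst measure_distr) (auto simp: vimage_def)

lemma prob_arrival_tendsto_0: "(\<lambda>M. W.prob {w. arrival w M \<le> t}) \<longlonglongrightarrow> 0"
proof -
  have "(\<lambda>M. \<integral>w. (indicator {w. arrival w M \<le> t} w :: real) \<partial>W) \<longlonglongrightarrow> (\<integral>w. 0 \<partial>W)"
  proof (rule integral_dominated_convergence[where w = "\<lambda>_. 1 :: real"])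
    show "AE w in W. (\<lambda>M. indicator {w. arrival w M \<le> t} w :: real) \<longlonglongrightarrow> 0"
      using AE_regular
    proof eventually_elim
      case (elim w)
      then have "finite {M. arrival w M \<le> t}" by (simp add: regular_def)
      then have "\<forall>\<^sub>F M in sequentially. \<not> arrival w M \<le> t"
        by (simp add: eventually_cofinite flip: cofinite_eq_sequentially)
      then show ?case
        by (intro tendsto_eventually) (auto elim: eventually_mono)
    qed
  qed (auto split: split_indicator)
  then show ?thesis by simp
qed

lemma prob_residual_greater:
  assumes "0 \<le> t"
  shows "W.prob {w. t < fst w k} = exp (- t)"
proof -
  have "emeasure W {w. t < fst w k} = (\<integral>\<^sup>+w. indicator {w. t < fst w k} w \<partial>W)"
    by (subst nn_integral_indicator) (auto intro!: sets_W_Collect)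
  also have "\<dots> = (\<integral>\<^sup>+w. \<integral>\<^sup>+y. indicator {w. t < fst w k} ((fst w)(k := y), snd w) \<partial>E \<partial>W)"
    by (rule nn_integral_resample_initial[symmetric]) simp
  also have "\<dots> = (\<integral>\<^sup>+w. \<integral>\<^sup>+y. (if t < y then 1 else 0) \<partial>E \<partial>W)"
    by (simp add: indicator_def of_bool_def)
  also have "\<dots> = ennreal (exp (- t))"
    using assms by (subst exponential_memoryless)
      (simp_all add: E.emeasure_space_1[simplified] W.emeasure_space_1[simplified])
  finally show ?thesis by (simp add: measure_def)
qed

text \<open>Pathwise, hybrid \<open>M\<close> after the swap is hybrid \<open>Suc M\<close>; since
  the swap preserves the law, all hybrids have the same law at time \<open>t\<close>.\<close>

lemma prob_hybrid_Suc:
  "W.prob {w. map (hybrid_load x t i M w) [0..<n] \<in> A} =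
   W.prob {w. map (hybrid_load x t i (Suc M) w) [0..<n] \<in> A}"
proof -
  let ?H = "\<lambda>M w. map (hybrid_load x t i M w) [0..<n]"
  have [measurable]: "?H M \<in> measurable W (count_space UNIV)" for M
    by (intro measurable_map_upt) measurable
  have [measurable]: "{w. ?H M w \<in> A} \<in> sets W" for M
    using measurable_sets[of "?H M" W "count_space UNIV" A] by (simp add: vimage_def)
  have "emeasure W {w. ?H M w \<in> A} = (\<integral>\<^sup>+w. indicator {w. ?H M w \<in> A} (swap x t i M w) \<partial>W)"
    by (subst nn_integral_swap) simp_all
  also have "\<dots> = (\<integral>\<^sup>+w. indicator {w. ?H (Suc M) w \<in> A} w \<partial>W)"
    by (rule nn_integral_cong_AE, use AE_regular in eventually_elim)
      (simp add: indicator_def hybrid_load_swap[THEN ext])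
  also have "\<dots> = emeasure W {w. ?H (Suc M) w \<in> A}"
    by simp
  finally show ?thesis by (simp add: measure_def)
qed

text \<open>Every hybrid has the law of the larger system, and hybrid \<open>M\<close> agrees with
  the smaller one unless the \<open>M\<close>-th arrival is by time \<open>t\<close> or the extra
  ball survives \<open>t\<close>. The former probability vanishes as \<open>M\<close> grows, the
  latter is \<open>exp (- t)\<close>.\<close>

lemma load_law_add_ball:
  assumes "length x = n" and "i < n" and "0 \<le> t"
  shows "\<bar>measure (load_law lam d n (x[i := Suc (x ! i)]) t) A - measure (load_law lam d n x t) A\<bar> \<le> exp (- t)"
proof -
  let ?H = "\<lambda>M w. map (hybrid_load x t i M w) [0..<n]"
  have H [measurable]: "?H M \<in> measurable W (count_space UNIV)" for M
    by (intro measurable_map_upt) measurable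
  have "W.prob {w. ?H M w \<in> A} = W.prob {w. ?H 0 w \<in> A}" for M
    by (induction M) (simp_all flip: prob_hybrid_Suc)
  moreover have "?H 0 w = load_vector n (x[i := Suc (x ! i)]) t w" for w
    using assms by (simp add: load_vector_def hybrid_load_0)
  ultimately have 0: "W.prob {w. ?H M w \<in> A} = measure (load_law lam d n (x[i := Suc (x ! i)]) t) A" for M
    by (simp add: prob_load_law)
  have "\<bar>W.prob {w. ?H M w \<in> A} - W.prob {w. load_vector n x t w \<in> A}\<bar> \<le>
      W.prob {w. arrival w M \<le> t} + exp (- t)" for M
  proof -
    let ?B = "{w. arrival w M \<le> t} \<union> {w. t < fst w (i, x ! i)}"
    have [measurable]: "?B \<in> sets W"
      by (intro sets.Un sets_W_Collect) measurable
    have "AE w in W. w \<notin> ?B \<longrightarrow> (?H M w \<in> A \<longleftrightarrow> load_vector n x t w \<in> A)"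
      using AE_regular
    proof eventually_elim
      case (elim w)
      have "?H M w = load_vector n x t w" if "w \<notin> ?B"
        unfolding load_vector_def
        by (intro map_cong refl hybrid_load_final elim) (use that in \<open>auto simp: extra_lifetime_def\<close>)
      then show ?case by simp
    qed
    then have "\<bar>W.prob {w \<in> space W. ?H M w \<in> A} - W.prob {w \<in> space W. load_vector n x t w \<in> A}\<bar> \<le> W.prob ?B"
      by (rule W.abs_prob_diff_le) measurable
    also have "\<dots> \<le> W.prob {w. arrival w M \<le> t} + W.prob {w. t < fst w (i, x ! i)}"
      by (rule measure_Un_le) (auto intro!: sets_W_Collect)
    finally show ?thesis
      using assms by (simp add: prob_residual_greater)
  qed
  then have bound: "\<bar>measure (load_law lam d n (x[i := Suc (x ! i)]) t) A - measure (load_law lam d n x t) A\<bar> \<le>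
      W.prob {w. arrival w M \<le> t} + exp (- t)" for M
    by (simp add: 0 flip: prob_load_law)
  have lim: "(\<lambda>M. W.prob {w. arrival w M \<le> t} + exp (- t)) \<longlonglongrightarrow> 0 + exp (- t)"
    by (intro tendsto_intros prob_arrival_tendsto_0)
  have "\<bar>measure (load_law lam d n (x[i := Suc (x ! i)]) t) A - measure (load_law lam d n x t) A\<bar> \<le>
      0 + exp (- t)"
    by (rule LIMSEQ_le_const[OF lim]) (use bound in blast)
  then show ?thesis by simp
qed

text \<open>The triangle inequality along a chain of states that removes one ball at a time.\<close>

lemma load_law_contraction:
  assumes "length x = n" and "0 \<le> t"
  shows "\<bar>measure (load_law lam d n x t) A - measure (load_law lam d n (replicate n 0) t) A\<bar> \<le>
    real (sum_list x) * exp (- t)"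
  using assms(1)
proof (induction "sum_list x" arbitrary: x)
  case 0
  then have "x = replicate n 0"
    by (metis replicate_eqI sum_list_eq_0_iff)
  then show ?case by simp
next
  case (Suc k x)
  obtain i where i: "i < n" "x ! i \<noteq> 0"
    using Suc.hyps(2) Suc.prems by (metis Zero_not_Suc in_set_conv_nth sum_list_eq_0_iff)
  define y where "y = x[i := x ! i - 1]"
  have x: "x = y[i := Suc (y ! i)]" and y: "length y = n"
    using i Suc.prems by (simp_all add: y_def)
  have "sum_list x = Suc (sum_list y)"
    unfolding y_def using i Suc.prems Suc.hyps(2) elem_le_sum_list[of i x] by (simp add: sum_list_update)
  then have k: "k = sum_list y" "sum_list x = Suc k"
    using Suc.hyps(2) by auto
  have "\<bar>measure (load_law lam d n y t) A - measure (load_law lam d n (replicate n 0) t) A\<bar> \<le> real k * exp (- t)"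
    using Suc.hyps(1)[OF k(1) y] k by simp
  moreover have "\<bar>measure (load_law lam d n x t) A - measure (load_law lam d n y t) A\<bar> \<le> exp (- t)"
    using load_law_add_ball[OF y i(1) assms(2)] x by simp
  ultimately show ?case
    by (simp add: k(2) algebra_simps)
qed

section \<open>Comparison with the stationary distribution\<close>

lemma prob_space_load_law: "prob_space (load_law lam d n x t)"
  unfolding load_law_def by (rule W.prob_space_distr) measurable

lemma stationary_diff_eq:
  assumes "stationary lam d n P" and "0 \<le> t"
  shows "measure_pmf.prob P A - measure (load_law lam d n y t) A =
    measure_pmf.expectation P (\<lambda>x. measure (load_law lam d n x t) A - measure (load_law lam d n y t) A)"
proof -
  have int: "integrable (measure_pmf P) (\<lambda>x. measure (load_law lam d n x t) A)"
    by (rule measure_pmf.integrable_const_bound[where B = 1])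
      (auto simp: prob_space.prob_le_1[OF prob_space_load_law])
  have "measure_pmf.expectation P (\<lambda>x. measure (load_law lam d n x t) A) = measure_pmf.prob P A"
    using assms unfolding stationary_def by blast
  then show ?thesis
    by (subst Bochner_Integration.integral_diff[OF int measure_pmf.integrable_const]) simp
qed

abbreviation "p0 t A \<equiv> measure (load_law lam d n (replicate n 0) t) A"

lemma stationary_length:
  "stationary lam d n P \<Longrightarrow> AE x in measure_pmf P. length x = n"
  by (auto simp: stationary_def AE_measure_pmf_iff)

lemma abs_diff_load_law_le_1:
  "\<bar>measure (load_law lam d n x t) A - measure (load_law lam d n y t) A\<bar> \<le> 1"
  using prob_space.prob_le_1[OF prob_space_load_law, of x t A]
    prob_space.prob_le_1[OF prob_space_load_law, of y t A]
    measure_nonneg[of "load_law lam d n x t" A] measure_nonneg[of "load_law lam d n y t" A]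
  unfolding abs_le_iff by linarith

text \<open>The contraction tends to 0 for each starting state, and dominated convergence averages
  it over \<open>P\<close> without any moment of \<open>P\<close>. Estimates for the empty start
  that hold for all late times thereby pass to \<open>P\<close>.\<close>

lemma load_law_tendsto_stationary:
  assumes P: "stationary lam d n P"
  shows "((\<lambda>t. p0 t A) \<longlongrightarrow> measure_pmf.prob P A) at_top"
proof -
  let ?f = "\<lambda>t x. measure (load_law lam d n x t) A - p0 t A"
  have "((\<lambda>t. \<integral>x. ?f t x \<partial>measure_pmf P) \<longlongrightarrow> (\<integral>x. 0 \<partial>measure_pmf P)) at_top"
  proof (rule integral_dominated_convergence_at_top[where w = "\<lambda>_. 1"])
    show "AE x in measure_pmf P. ((\<lambda>t. ?f t x) \<longlongrightarrow> 0) at_top"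
      using stationary_length[OF P]
    proof eventually_elim
      case (elim x)
      have "((\<lambda>t. real (sum_list x) * exp (- t)) \<longlongrightarrow> real (sum_list x) * 0) at_top"
        by (intro tendsto_mult tendsto_const filterlim_compose[OF exp_at_bot filterlim_uminus_at_bot_at_top])
      moreover have "\<forall>\<^sub>F t in at_top. norm (?f t x) \<le> real (sum_list x) * exp (- t)"
        using eventually_ge_at_top[of 0]
        by eventually_elim (simp only: real_norm_def load_law_contraction[OF elim])
      ultimately show ?case
        by (simp add: Lim_null_comparison)
    qed
    show "\<forall>\<^sub>F t in at_top. AE x in measure_pmf P. norm (?f t x) \<le> 1"
      by (simp only: real_norm_def abs_diff_load_law_le_1) simp
  qed simp_all
  then have "((\<lambda>t. \<integral>x. ?f t x \<partial>measure_pmf P) \<longlongrightarrow> 0) at_top"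
    by simp
  moreover have "\<forall>\<^sub>F t in at_top. (\<integral>x. ?f t x \<partial>measure_pmf P) = measure_pmf.prob P A - p0 t A"
    using eventually_ge_at_top[of 0]
    by eventually_elim (rule stationary_diff_eq[OF P, symmetric])
  ultimately have "((\<lambda>t. measure_pmf.prob P A - p0 t A) \<longlongrightarrow> 0) at_top"
    by (rule Lim_transform_eventually)
  then have "((\<lambda>t. measure_pmf.prob P A - (measure_pmf.prob P A - p0 t A)) \<longlongrightarrow> measure_pmf.prob P A - 0) at_top"
    by (intro tendsto_intros)
  then show ?thesis by simp
qed

text \<open>Starting states with more than \<open>K\<close> balls are charged the trivial bound 1,
  the others the contraction.\<close>

lemma abs_stationary_diff_le:
  assumes P: "stationary lam d n P" and "0 \<le> t" and "0 \<le> K"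
  shows "\<bar>p0 t A - measure_pmf.prob P A\<bar> \<le>
    measure_pmf.prob P {x. K < real (sum_list x)} + K * exp (- t)"
proof -
  let ?f = "\<lambda>x. measure (load_law lam d n x t) A - p0 t A"
  have int: "integrable (measure_pmf P) (indicator {x. K < real (sum_list x)} :: nat list \<Rightarrow> real)"
    by (rule measure_pmf.integrable_const_bound[where B = 1]) auto
  have "\<bar>p0 t A - measure_pmf.prob P A\<bar> = \<bar>\<integral>x. ?f x \<partial>measure_pmf P\<bar>"
    using stationary_diff_eq[OF P \<open>0 \<le> t\<close>, of A "replicate n 0"] by (simp add: abs_minus_commute)
  also have "\<dots> \<le> (\<integral>x. \<bar>?f x\<bar> \<partial>measure_pmf P)"
    by (rule integral_abs_bound)
  also have "\<dots> \<le> (\<integral>x. indicator {x. K < real (sum_list x)} x + K * exp (- t) \<partial>measure_pmf P)"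
  proof (rule integral_mono_AE)
    show "integrable (measure_pmf P) (\<lambda>x. \<bar>?f x\<bar>)"
      by (rule measure_pmf.integrable_const_bound[where B = 1]) (auto simp: abs_diff_load_law_le_1)
    show "AE x in measure_pmf P. \<bar>?f x\<bar> \<le> indicator {x. K < real (sum_list x)} x + K * exp (- t)"
      using stationary_length[OF P]
    proof eventually_elim
      case (elim x)
      show ?case
      proof (cases "K < real (sum_list x)")
        case True
        with \<open>0 \<le> K\<close> abs_diff_load_law_le_1[of x t A "replicate n 0"] show ?thesis
          by (simp add: add_increasing2)
      next
        case False
        then have "real (sum_list x) * exp (- t) \<le> K * exp (- t)"
          by (intro mult_right_mono) auto
        with load_law_contraction[OF elim \<open>0 \<le> t\<close>, of A] have "\<bar>?f x\<bar> \<le> K * exp (- t)"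
          by (rule order.trans)
        with False show ?thesis by simp
      qed
    qed
  qed (rule Bochner_Integration.integrable_add[OF int measure_pmf.integrable_const])
  also have "\<dots> = measure_pmf.prob P {x. K < real (sum_list x)} + K * exp (- t)"
    by (subst Bochner_Integration.integral_add[OF int measure_pmf.integrable_const]) simp
  finally show ?thesis .
qed

section \<open>Concentration of the total load started from empty\<close>

definition total :: "real \<Rightarrow> outcome \<Rightarrow> real" where
  "total t w = real (sum_list (load_vector n (replicate n 0) t w))"

lemma measurable_total [measurable]: "total t \<in> borel_measurable W"
  unfolding total_def[abs_def] by (rule measurable_compose[OF measurable_load_vector]) simp

lemma p0_total: "p0 t {x. real (sum_list x) \<in> B} = W.prob {w. total t w \<in> B}"
  by (simp add: prob_load_law total_def)

text \<open>Almost surely each ball goes to exactly one of the bins \<open>{..<n}\<close>, so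
  summing over bins removes the placement rule and leaves a count that depends on the marks
  alone.\<close>

lemma AE_total:
  assumes "0 \<le> t"
  shows "AE w in W. ennreal (total t w) = population t (snd w)"
proof -
  have "AE w in W. finite {m. alive t (snd w) m}"
    unfolding outcomes_eq by (rule RS.AE_pair_snd[OF AE_finite_alive[OF assms]])
  with AE_regular_marks show ?thesis
  proof eventually_elim
    case (elim w)
    let ?b = "ball_bin (replicate n 0) w"
    let ?A = "{m. alive t (snd w) m}"
    have b: "?b m < n" for m
      using elim(1) arg_min_list_in[of "choices w m"] unfolding ball_bin_eq[of _ _ m] by blast
    have "load (replicate n 0) w t j = card {m \<in> ?A. ?b m = j}" if "j < n" for j
      using that by (auto simp: load_def initial_load_def alive_def arrival_eq lifetime_eq intro!: arg_cong[where f = card])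
    then have "sum_list (load_vector n (replicate n 0) t w) = (\<Sum>j<n. card {m \<in> ?A. ?b m = j})"
      by (simp add: load_vector_def sum_list_sum_nth atLeast0LessThan)
    also have "\<dots> = card (\<Union>j<n. {m \<in> ?A. ?b m = j})"
      using elim(2) by (intro card_UN_disjoint[symmetric]) auto
    also have "(\<Union>j<n. {m \<in> ?A. ?b m = j}) = ?A"
      using b by auto
    finally show ?case
      using elim(2) by (simp add: total_def population_def suminf_of_bool_ennreal ennreal_of_nat_eq_real_of_nat)
  qed
qed

lemma nn_integral_W_snd:
  assumes [measurable]: "g \<in> borel_measurable S"
  shows "(\<integral>\<^sup>+w. g (snd w) \<partial>W) = (\<integral>\<^sup>+a. g a \<partial>S)"
  unfolding outcomes_eq by (subst RS.nn_integral_snd[symmetric]) (auto simp: R.emeasure_space_1[simplified])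

lemma total_nonneg [simp]: "0 \<le> total t w"
  by (simp add: total_def)

lemma nn_integral_total:
  assumes "0 \<le> t"
  shows "(\<integral>\<^sup>+w. ennreal (total t w) \<partial>W) = ennreal (mean_population t)"
proof -
  have "(\<integral>\<^sup>+w. ennreal (total t w) \<partial>W) = (\<integral>\<^sup>+w. population t (snd w) \<partial>W)"
    by (rule nn_integral_cong_AE[OF AE_total[OF assms]])
  then show ?thesis
    by (simp add: nn_integral_W_snd nn_integral_population[OF assms])
qed

lemma nn_integral_total_square:
  assumes "0 \<le> t"
  shows "(\<integral>\<^sup>+w. ennreal (total t w ^ 2) \<partial>W) \<le> ennreal (mean_population t + mean_population t ^ 2)"
proof -
  have "(\<integral>\<^sup>+w. ennreal (total t w ^ 2) \<partial>W) = (\<integral>\<^sup>+w. population t (snd w) ^ 2 \<partial>W)"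
    by (rule nn_integral_cong_AE) (use AE_total[OF assms] in \<open>auto simp flip: ennreal_power elim!: eventually_mono\<close>)
  also have "\<dots> = (\<integral>\<^sup>+a. population t a ^ 2 \<partial>S)"
    by (rule nn_integral_W_snd) measurable
  finally show ?thesis
    using nn_integral_population_square[OF assms] by simp
qed

lemma integrable_total: "0 \<le> t \<Longrightarrow> integrable W (total t)"
  by (rule integrableI_nonneg) (auto simp: nn_integral_total)

lemma integrable_total_square: "0 \<le> t \<Longrightarrow> integrable W (\<lambda>w. total t w ^ 2)"
  by (rule integrableI_nonneg) (auto intro: le_less_trans[OF nn_integral_total_square])

lemma expectation_total: "0 \<le> t \<Longrightarrow> W.expectation (total t) = mean_population t"
  by (subst integral_eq_nn_integral) (auto simp: nn_integral_total mean_population_nonneg)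

lemma variance_total_le:
  assumes "0 \<le> t"
  shows "W.variance (total t) \<le> mean_population t"
proof -
  have "W.expectation (\<lambda>w. total t w ^ 2) \<le> mean_population t + mean_population t ^ 2"
    using nn_integral_total_square[OF assms] mean_population_nonneg[OF assms]
    by (subst integral_eq_nn_integral) (auto intro: enn2real_leI)
  then show ?thesis
    using W.variance_eq[OF integrable_total[OF assms] integrable_total_square[OF assms]]
    by (simp add: expectation_total[OF assms])
qed

lemma mean_population_le: "mean_population t \<le> l"
  using rate_pos lam_pos by (simp add: mean_population_def right_diff_distrib)

lemma Chebyshev_total:
  assumes "0 \<le> t" and "0 < D"
  shows "W.prob {w. D \<le> \<bar>total t w - mean_population t\<bar>} \<le> l / D ^ 2"
proof -
  have "W.prob {w. D \<le> \<bar>total t w - mean_population t\<bar>} \<le> W.variance (total t) / D ^ 2"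
    using W.Chebyshev_inequality[of "total t" D] assms
    by (simp add: integrable_total_square expectation_total)
  also have "\<dots> \<le> l / D ^ 2"
    using variance_total_le[OF assms(1)] mean_population_le[of t] by (intro divide_right_mono) auto
  finally show ?thesis .
qed

text \<open>Markov's inequality for the empty start is uniform in time, since the mean never exceeds
  \<open>l\<close>, and so survives the limit.\<close>

lemma stationary_tail:
  assumes P: "stationary lam d n P" and "0 < K"
  shows "measure_pmf.prob P {x. K < real (sum_list x)} \<le> l / K"
proof (rule tendsto_upperbound[OF load_law_tendsto_stationary[OF P]])
  show "\<forall>\<^sub>F t in at_top. p0 t {x. K < real (sum_list x)} \<le> l / K"
    using eventually_ge_at_top[of 0]
  proof eventually_elim
    case (elim t)
    have "p0 t {x. K < real (sum_list x)} = W.prob {w. K < total t w}"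
      using p0_total[of t "{K<..}"] by simp
    also have "\<dots> \<le> W.prob {w \<in> space W. K \<le> total t w}"
      by (rule W.finite_measure_mono) (auto intro!: sets_W_Collect)
    also have "\<dots> \<le> W.expectation (total t) / K"
      using \<open>0 < K\<close> integrable_total[OF elim] by (intro integral_Markov_inequality_measure[where A = "{}"]) auto
    also have "\<dots> \<le> l / K"
      using \<open>0 < K\<close> mean_population_le[of t] by (simp add: expectation_total[OF elim] divide_right_mono)
    finally show ?case .
  qed
qed simp

section \<open>Bounds on total variation distance and mixing time\<close>

lemma tv_dist_le:
  assumes P: "stationary lam d n P" and "0 \<le> t" and "0 < K"
  shows "tv_dist (load_law lam d n (replicate n 0) t) (measure_pmf P) \<le> l / K + K * exp (- t)"
  unfolding tv_dist_def
proof (rule cSUP_least)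
  fix A
  show "\<bar>p0 t A - measure_pmf.prob P A\<bar> \<le> l / K + K * exp (- t)"
    using abs_stationary_diff_le[OF P \<open>0 \<le> t\<close>, of K A] stationary_tail[OF P \<open>0 < K\<close>] \<open>0 < K\<close> by simp
qed auto

text \<open>The test event is a total below \<open>l - D\<close>. At time \<open>t\<close> the mean
  is at most \<open>l - 2 * D\<close>, so failing it is a deviation of at least \<open>D\<close>.
  For late \<open>s\<close> the mean exceeds \<open>l - D / 2\<close>, so the event is a deviation
  of at least \<open>D / 2\<close>. Chebyshev's inequality costs \<open>l / D ^ 2\<close> and
  \<open>4 * l / D ^ 2\<close>, together the 5.\<close>

lemma tv_dist_ge:
  assumes P: "stationary lam d n P" and t: "0 \<le> t" and D: "0 < D" and "2 * D \<le> l * exp (- t)"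
  shows "1 - 5 * l / D ^ 2 \<le> tv_dist (load_law lam d n (replicate n 0) t) (measure_pmf P)"
proof -
  let ?A = "{x. real (sum_list x) < l - D}"
  have p0: "p0 s ?A = W.prob {w. total s w < l - D}" for s
    using p0_total[of s "{..<l - D}"] by simp
  have "1 - l / D ^ 2 \<le> p0 t ?A"
  proof -
    have "1 - p0 t ?A = W.prob {w \<in> space W. \<not> total t w < l - D}"
      unfolding p0 by (subst W.prob_neg) (auto intro!: sets_W_Collect)
    also have "\<dots> \<le> W.prob {w. D \<le> \<bar>total t w - mean_population t\<bar>}"
      by (rule W.finite_measure_mono) (use assms in \<open>auto simp: mean_population_def algebra_simps intro!: sets_W_Collect\<close>)
    also have "\<dots> \<le> l / D ^ 2"
      by (rule Chebyshev_total[OF t D])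
    finally show ?thesis by simp
  qed
  moreover have "measure_pmf.prob P ?A \<le> 4 * l / D ^ 2"
  proof (rule tendsto_upperbound[OF load_law_tendsto_stationary[OF P]])
    have "((\<lambda>s. l * exp (- s)) \<longlongrightarrow> l * 0) at_top"
      by (intro tendsto_mult tendsto_const filterlim_compose[OF exp_at_bot filterlim_uminus_at_bot_at_top])
    then have "\<forall>\<^sub>F s in at_top. l * exp (- s) < D / 2"
      using D by (intro order_tendstoD(2)[where y = "l * 0"]) auto
    then show "\<forall>\<^sub>F s in at_top. p0 s ?A \<le> 4 * l / D ^ 2"
      using eventually_ge_at_top[of 0]
    proof eventually_elim
      case (elim s)
      have "D / 2 \<le> \<bar>total s w - mean_population s\<bar>" if "total s w < l - D" for w
      proof -
        have "mean_population s = l - l * exp (- s)"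
          by (simp add: mean_population_def right_diff_distrib)
        with that elim have "D / 2 \<le> - (total s w - mean_population s)" by linarith
        then show ?thesis by linarith
      qed
      then have "p0 s ?A \<le> W.prob {w. D / 2 \<le> \<bar>total s w - mean_population s\<bar>}"
        unfolding p0 by (intro W.finite_measure_mono) (auto intro!: sets_W_Collect)
      also have "\<dots> \<le> l / (D / 2) ^ 2"
        using D elim by (intro Chebyshev_total) auto
      finally show ?case by (simp add: power_divide mult.commute)
    qed
  qed simp
  ultimately have "1 - 5 * l / D ^ 2 \<le> \<bar>p0 t ?A - measure_pmf.prob P ?A\<bar>"
    by (simp add: diff_divide_distrib)
  also have "\<dots> \<le> tv_dist (load_law lam d n (replicate n 0) t) (measure_pmf P)"
    unfolding tv_dist_def
  proof (rule cSUP_upper)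
    show "?A \<in> sets (load_law lam d n (replicate n 0) t)"
      by (simp add: load_law_def)
    have "\<bar>p0 t A - measure_pmf.prob P A\<bar> \<le> 1" for A
      using prob_space.prob_le_1[OF prob_space_load_law, of "replicate n 0" t A] measure_pmf.prob_le_1[of P A]
        measure_nonneg[of "load_law lam d n (replicate n 0) t" A] measure_nonneg[of "measure_pmf P" A]
      unfolding abs_le_iff by linarith
    then show "bdd_above ((\<lambda>A. \<bar>p0 t A - measure_pmf.prob P A\<bar>) ` sets (load_law lam d n (replicate n 0) t))"
      by (intro bdd_aboveI2)
  qed
  finally show ?thesis .
qed

text \<open>With \<open>K = 4 * l\<close> the tail term is 1/4, and at time \<open>2 * ln n\<close>
  the contraction term is \<open>4 * lam / n\<close>, at most 1/4 once
  \<open>16 * lam \<le> n\<close>.\<close>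

lemma mixing_time_le:
  assumes P: "stationary lam d n P" and n: "16 * lam \<le> real n"
  shows "mixing_time lam d n P (1/2) (replicate n 0) \<le> ereal (2 * ln (real n))"
proof -
  have t: "0 \<le> 2 * ln (real n)"
    using n_pos by simp
  have "exp (- (2 * ln (real n))) = 1 / real n ^ 2"
    using n_pos by (simp add: exp_minus exp_double field_simps)
  then have "4 * l * exp (- (2 * ln (real n))) = 4 * lam / real n"
    using n_pos by (simp add: field_simps power2_eq_square)
  also have "\<dots> \<le> 1 / 4"
    using n n_pos by (simp add: field_simps)
  finally have "l / (4 * l) + 4 * l * exp (- (2 * ln (real n))) \<le> 1 / 2"
    using lam_pos n_pos by simp
  then have "tv_dist (load_law lam d n (replicate n 0) (2 * ln (real n))) (measure_pmf P) \<le> 1 / 2"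
    using tv_dist_le[OF P t, of "4 * l"] rate_pos by linarith
  then show ?thesis
    unfolding mixing_time_def using t by (intro Inf_lower) auto
qed

lemma mixing_time_ge:
  assumes P: "stationary lam d n P" and n: "40 / lam < sqrt (real n)"
  shows "ereal (ln (real n) / 4) \<le> mixing_time lam d n P (1/2) (replicate n 0)"
  unfolding mixing_time_def
proof (intro Inf_greatest, elim imageE, rule ccontr)
  fix y t
  assume "t \<in> {t. 0 \<le> t \<and> tv_dist (load_law lam d n (replicate n 0) t) (measure_pmf P) \<le> 1 / 2}"
    and "y = ereal t" "\<not> ereal (ln (real n) / 4) \<le> y"
  then have t: "0 \<le> t" "tv_dist (load_law lam d n (replicate n 0) t) (measure_pmf P) \<le> 1 / 2"
    and "\<not> ln (real n) / 4 \<le> t"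
    by auto
  \<comment> \<open>Before time \<open>ln n / 4\<close> the deficit \<open>l * exp (- t)\<close> is
    at least \<open>lam * n powr (3/4)\<close>, which is \<open>2 * D\<close>. The error
    \<open>5 * l / D ^ 2\<close> is then \<open>20 / (lam * sqrt n)\<close>, below 1/2 exactly when
    \<open>40 / lam < sqrt n\<close>.\<close>
  define D where "D = lam * real n powr (3/4) / 2"
  have D: "0 < D" using lam_pos n_pos by (simp add: D_def)
  have "real n powr (3/4) = real n * exp (- (ln (real n) / 4))"
    using n_pos by (simp add: powr_def exp_minus exp_diff field_simps flip: exp_add)
  also have "\<dots> \<le> real n * exp (- t)"
    using \<open>\<not> ln (real n) / 4 \<le> t\<close> by (intro mult_left_mono) auto
  finally have "2 * D \<le> l * exp (- t)"
    using lam_pos by (simp add: D_def)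
  then have le: "1 - 5 * l / D ^ 2 \<le> 1 / 2"
    using tv_dist_ge[OF P t(1) D] t(2) by simp
  have D2: "D ^ 2 = lam ^ 2 * (real n * sqrt (real n)) / 4"
  proof -
    have "(real n powr (3/4)) ^ 2 = real n powr (1 + 1/2)"
      using n_pos by (simp add: powr_power)
    also have "\<dots> = real n * sqrt (real n)"
      using n_pos by (subst powr_add) (simp add: powr_half_sqrt)
    finally show ?thesis by (simp add: D_def power_mult_distrib power_divide)
  qed
  have "5 * l / D ^ 2 = 20 / (lam * sqrt (real n))"
    unfolding D2 using lam_pos n_pos by (simp add: field_simps power2_eq_square)
  moreover have "20 / (lam * sqrt (real n)) < 1 / 2"
    using n lam_pos n_pos by (simp add: field_simps)
  ultimately show False using le by simp
qed

end

theorem mainTheorem2: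
  fixes lam :: real and d :: nat and P :: "nat \<Rightarrow> nat list pmf"
  assumes "lam > 0" and "d > 0"
    and "\<And>n. n > 0 \<Longrightarrow> stationary lam d n (P n)"
  shows "(\<lambda>n. real_of_ereal (mixing_time lam d n (P n) (1/2) (replicate n 0))) \<in> \<Theta>(\<lambda>n. ln (real n))"
proof -
  let ?\<tau> = "\<lambda>n. mixing_time lam d n (P n) (1/2) (replicate n 0)"
  define f where "f n = real_of_ereal (?\<tau> n)" for n
  have "filterlim (\<lambda>n. sqrt (real n)) at_top sequentially"
    by (rule filterlim_compose[OF sqrt_at_top filterlim_real_sequentially])
  then have "\<forall>\<^sub>F n in sequentially. 40 / lam < sqrt (real n)"
    by (simp add: filterlim_at_top_dense)
  moreover have "\<forall>\<^sub>F n in sequentially. 16 * lam \<le> real n"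
    using filterlim_real_sequentially by (simp add: filterlim_at_top)
  ultimately have ev: "\<forall>\<^sub>F n in sequentially.
      ln (real n) / 4 \<le> f n \<and> f n \<le> 2 * ln (real n) \<and>
      0 \<le> ln (real n) \<and> 0 \<le> f n"
    using eventually_gt_at_top[of 0]
  proof eventually_elim
    case (elim n)
    interpret bins lam d n
      using assms elim by unfold_locales auto
    have "ereal (ln (real n) / 4) \<le> ?\<tau> n" "?\<tau> n \<le> ereal (2 * ln (real n))"
      using mixing_time_ge[OF assms(3)] mixing_time_le[OF assms(3)] elim by auto
    moreover have "0 \<le> ln (real n)" using elim by simp
    \<comment> \<open>The mixing time lies between two finite bounds, so
      \<open>real_of_ereal\<close> does not fall back on its value 0 at infinity.\<close>
    ultimately show ?case
      unfolding f_def by (cases "?\<tau> n") auto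
  qed
  show ?thesis
    unfolding f_def[symmetric]
  proof (rule bigthetaI)
    show "f \<in> O(\<lambda>n. ln (real n))"
      by (rule bigoI[where c = 2]) (use ev in \<open>auto elim!: eventually_mono\<close>)
    show "f \<in> \<Omega>(\<lambda>n. ln (real n))"
      by (rule landau_omega.bigI[where c = "1/4"]) (use ev in \<open>auto elim!: eventually_mono\<close>)
  qed
qed

end
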